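(* Let $a,b,c,d\in C[-1,1]$ satisfy $0<\alpha\le a(x),\,b(y)\le\beta$ for all $x,y\in[-1,1]$, with constants $\alpha,\beta$, and suppose $c(x)d(y)\equiv s$ on $[-1,1]^2$ for some constant $s\ge0$. For $N\ge2$ let $\mathbf A_{\rm L},\mathbf A_{\rm B},\mathbf P_{\rm L},\mathbf P_{\rm B}$ be the Lagrange and Birkhoff collocation matrices and the corresponding preconditioners of the operator $\mathcal L[u]=-a(x)\partial_{xx}u-b(y)\partial_{yy}u+c(x)d(y)u$ on $(-1,1)^2$. Then $$\kappa_2(\mathbf A_{\rm L}\mathbf P_{\rm L})=\kappa_2(\mathbf A_{\rm B}\mathbf P_{\rm B})=\mathcal O(1)$$ uniformly in $N$; that is, these condition numbers are bounded by a constant independent of $N$.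
   Context: $\mathbb P_N$ is the space of real polynomials of degree at most $N$. The Legendre-Gauss-Lobatto (LGL) nodes $-1=x_0<x_1<\cdots<x_N=1$ are the zeros of $(1-x^2)L_N'(x)$; the same nodes are used in the $y$ direction, $y_j=x_j$. Let $\ell_j\in\mathbb P_N$ be the Lagrange basis polynomials, $\ell_j(x_i)=\delta_{ij}$, and $\mathbf D^{(2)}=(\ell_j''(x_i))_{1\le i,j\le N-1}$. For $1\le j\le N-1$, $B_j\in\mathbb P_N$ is the unique polynomial with $B_j(\pm1)=0$, $B_j''(x_i)=\delta_{ij}$ ($1\le i\le N-1$), and $\mathbf B=(B_j(x_i))_{1\le i,j\le N-1}=(\mathbf D^{(2)})^{-1}$. Put $\mathbf C_a=\operatorname{diag}(a(x_i))_{i=1}^{N-1}$, $\mathbf C_c=\operatorname{diag}(c(x_i))_{i=1}^{N-1}$, $\mathbf C_b=\operatorname{diag}(b(y_j))_{j=1}^{N-1}$, $\mathbf C_d=\operatorname{diag}(d(y_j))_{j=1}^{N-1}$. With $\otimes$ the Kronecker product, $$\mathbf K_{\rm L}=-\mathbf I_{N-1}\otimes(\mathbf C_a\mathbf D^{(2)})-(\mathbf C_b\mathbf D^{(2)})\otimes\mathbf I_{N-1},\quad \mathbf A_{\rm L}=\mathbf K_{\rm L}+\mathbf C_d\otimes\mathbf C_c,\quad \mathbf P_{\rm L}=\mathbf K_{\rm L}^{-1},$$ $$\mathbf K_{\rm B}=-\mathbf B\otimes\mathbf C_a-\mathbf C_b\otimes\mathbf B,\quad \mathbf A_{\rm B}=\mathbf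 K_{\rm B}+(\mathbf C_d\mathbf B)\otimes(\mathbf C_c\mathbf B),\quad \mathbf P_{\rm B}=\mathbf K_{\rm B}^{-1}.$$ $\kappa_2(\mathbf M)=\|\mathbf M\|_2\|\mathbf M^{-1}\|_2$ is the Euclidean 2-norm condition number. *)

theory Defs
  imports
    Complex_Main
    "HOL-Computational_Algebra.Polynomial"
    "Jordan_Normal_Form.Gauss_Jordan_Elimination"
begin

text \<open>Rodrigues' formula.\<close>

definition legendre_poly :: "nat \<Rightarrow> real poly" where
  "legendre_poly n = Polynomial.smult (1 / (2 ^ n * fact n)) ((pderiv ^^ n) ([:-1, 0, 1:] ^ n))"

text \<open>The zeros of $(1 - x^2) L_N'(x)$ in increasing order, numbered from \<open>0\<close> to \<open>N\<close>.\<close>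

definition lgl_node :: "nat \<Rightarrow> nat \<Rightarrow> real" where
  "lgl_node N i =
     sorted_list_of_set {x. poly ([:1, 0, -1:] * pderiv (legendre_poly N)) x = 0} ! i"

definition lagrange_basis :: "nat \<Rightarrow> nat \<Rightarrow> real poly" where
  "lagrange_basis N j =
     (THE p. degree p \<le> N \<and> (\<forall>i\<le>N. poly p (lgl_node N i) = (if i = j then 1 else 0)))"

definition birkhoff_basis :: "nat \<Rightarrow> nat \<Rightarrow> real poly" where
  "birkhoff_basis N j =
     (THE p. degree p \<le> N \<and> poly p (-1) = 0 \<and> poly p 1 = 0 \<and>
        (\<forall>i\<in>{1..N-1}. poly (pderiv (pderiv p)) (lgl_node N i) = (if i = j then 1 else 0)))"

text \<open>
  Matrix rows and columns are counted from \<open>0\<close>, so index \<open>i\<close> of an \<open>(N - 1)\<close>-dimensional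
  matrix belongs to the interior node with number \<open>i + 1\<close>.
\<close>

definition D2_mat :: "nat \<Rightarrow> real mat" where
  "D2_mat N = mat (N - 1) (N - 1)
     (\<lambda>(i, j). poly (pderiv (pderiv (lagrange_basis N (j + 1)))) (lgl_node N (i + 1)))"

definition B_mat :: "nat \<Rightarrow> real mat" where
  "B_mat N = mat (N - 1) (N - 1)
     (\<lambda>(i, j). poly (birkhoff_basis N (j + 1)) (lgl_node N (i + 1)))"

definition coeff_mat :: "nat \<Rightarrow> (real \<Rightarrow> real) \<Rightarrow> real mat" where
  "coeff_mat N f = mat_diag (N - 1) (\<lambda>i. f (lgl_node N (i + 1)))"

definition kronecker :: "real mat \<Rightarrow> real mat \<Rightarrow> real mat"  (infixl \<open>\<otimes>\<^sub>K\<close> 70) where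
  "A \<otimes>\<^sub>K B = mat (dim_row A * dim_row B) (dim_col A * dim_col B)
     (\<lambda>(i, j). A $$ (i div dim_row B, j div dim_col B) * B $$ (i mod dim_row B, j mod dim_col B))"

text \<open>Only meaningful for an invertible argument.\<close>

definition inv_mat :: "real mat \<Rightarrow> real mat" where
  "inv_mat A = the (mat_inverse A)"

definition vec_norm2 :: "real vec \<Rightarrow> real" where
  "vec_norm2 v = sqrt (v \<bullet> v)"

definition mat_norm2 :: "real mat \<Rightarrow> real" where
  "mat_norm2 A = (SUP v \<in> {v \<in> carrier_vec (dim_col A). vec_norm2 v \<le> 1}. vec_norm2 (A *\<^sub>v v))"

definition cond2 :: "real mat \<Rightarrow> real" where
  "cond2 A = mat_norm2 A * mat_norm2 (inv_mat A)"

definition K_L :: "nat \<Rightarrow> (real \<Rightarrow> real) \<Rightarrow> (real \<Rightarrow> real) \<Rightarrow> real mat" where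
  "K_L N a b = - (1\<^sub>m (N - 1) \<otimes>\<^sub>K (coeff_mat N a * D2_mat N))
             - ((coeff_mat N b * D2_mat N) \<otimes>\<^sub>K 1\<^sub>m (N - 1))"

definition A_L :: "nat \<Rightarrow> (real \<Rightarrow> real) \<Rightarrow> (real \<Rightarrow> real) \<Rightarrow> (real \<Rightarrow> real) \<Rightarrow> (real \<Rightarrow> real)
    \<Rightarrow> real mat" where
  "A_L N a b c d = K_L N a b + coeff_mat N d \<otimes>\<^sub>K coeff_mat N c"

definition P_L :: "nat \<Rightarrow> (real \<Rightarrow> real) \<Rightarrow> (real \<Rightarrow> real) \<Rightarrow> real mat" where
  "P_L N a b = inv_mat (K_L N a b)"

definition K_B :: "nat \<Rightarrow> (real \<Rightarrow> real) \<Rightarrow> (real \<Rightarrow> real) \<Rightarrow> real mat" where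
  "K_B N a b = - (B_mat N \<otimes>\<^sub>K coeff_mat N a) - (coeff_mat N b \<otimes>\<^sub>K B_mat N)"

definition A_B :: "nat \<Rightarrow> (real \<Rightarrow> real) \<Rightarrow> (real \<Rightarrow> real) \<Rightarrow> (real \<Rightarrow> real) \<Rightarrow> (real \<Rightarrow> real)
    \<Rightarrow> real mat" where
  "A_B N a b c d = K_B N a b + (coeff_mat N d * B_mat N) \<otimes>\<^sub>K (coeff_mat N c * B_mat N)"

definition P_B :: "nat \<Rightarrow> (real \<Rightarrow> real) \<Rightarrow> (real \<Rightarrow> real) \<Rightarrow> real mat" where
  "P_B N a b = inv_mat (K_B N a b)"

end

theory Submission
  imports Defs "HOL-Analysis.L2_Norm" "Jordan_Normal_Form.Determinant"
begin

text \<open>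
  Since \<open>B\<close> is the inverse of \<open>D\<^sup>(\<^sup>2\<^sup>)\<close>, multiplying \<open>K\<^sub>L\<close> and \<open>A\<^sub>L\<close> on the right by \<open>B \<otimes> B\<close> gives \<open>K\<^sub>B\<close> and
  \<open>A\<^sub>B\<close>, so the two preconditioned matrices coincide. As \<open>c d \<equiv> s\<close>, they equal \<open>(K + s) K\<^sup>-\<^sup>1\<close> with
  \<open>K = K\<^sub>L\<close>, and it suffices to bound \<open>(K + s)\<^sup>-\<^sup>1\<close> in the Euclidean norm uniformly in \<open>N\<close> for every
  \<open>s \<ge> 0\<close>.

  This follows by testing \<open>K v + s v\<close> with \<open>\<theta>\<^sub>p \<theta>\<^sub>q v\<^sub>p\<^sub>q / (a\<^sub>q b\<^sub>p)\<close>, where the weights \<open>\<theta>\<close> have values in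
  \<open>[1, 9/8]\<close> and make \<open>- D\<^sup>(\<^sup>2\<^sup>)\<close> coercive with a constant independent of \<open>N\<close>: dividing by \<open>a b\<close> leaves
  in each direction a coefficient that depends only on the other variable. The weights are multiples
  of \<open>w\<^sub>i (1 - x\<^sub>i\<^sup>2)\<^sup>-\<^sup>1\<^sup>/\<^sup>2\<close>, with \<open>w\<^sub>i\<close> the quadrature weights. Exactness of the quadrature gives coercivity
  for the weights \<open>w\<^sub>i\<close> and for \<open>w\<^sub>i / (1 - x\<^sub>i\<^sup>2)\<close>, and a Lyapunov argument interpolates between the
  two. That \<open>\<theta>\<close> is nearly constant follows from \<open>w\<^sub>i = 2 / (N (N + 1) L\<^sub>N(x\<^sub>i)\<^sup>2)\<close> and the monotonicity of
  two Sonin functions of \<open>L\<^sub>N\<close>.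
\<close>

lemmas pderiv_rules =
  pderiv_add pderiv_diff pderiv_minus pderiv_smult pderiv_pCons pderiv_mult

subsection \<open>Integration of polynomials over [-1, 1]\<close>

definition antideriv :: "real poly \<Rightarrow> real poly" where
  "antideriv p = (\<Sum>i\<le>degree p. monom (coeff p i / real (i + 1)) (i + 1))"

lemma pderiv_antideriv: "pderiv (antideriv p) = p"
proof -
  have "pderiv (antideriv p) = (\<Sum>i\<le>degree p. monom (coeff p i) i)"
    unfolding antideriv_def by (simp add: higher_pderiv_sum[of 1, simplified] pderiv_monom)
  then show ?thesis by (simp add: poly_as_sum_of_monoms)
qed

text \<open>Only polynomials are integrated, so the integral over [-1, 1] is the difference of the
  end values of an antiderivative; linearity and integration by parts then follow from the rules of
  \<open>pderiv\<close>.\<close>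

definition integ :: "real poly \<Rightarrow> real" where
  "integ p = poly (antideriv p) 1 - poly (antideriv p) (-1)"

lemma integ_pderiv: "integ (pderiv p) = poly p 1 - poly p (-1)"
proof -
  have "pderiv (antideriv (pderiv p) - p) = 0"
    by (simp add: pderiv_diff pderiv_antideriv)
  then obtain c where "antideriv (pderiv p) - p = [:c:]"
    by (metis pderiv_eq_0_iff degree_eq_zeroE)
  then have "antideriv (pderiv p) = p + [:c:]" by (simp add: algebra_simps)
  then show ?thesis by (simp add: integ_def)
qed

lemma integ_eqI: "pderiv q = p \<Longrightarrow> integ p = poly q 1 - poly q (-1)"
  using integ_pderiv by blast

lemma integ_add: "integ (p + q) = integ p + integ q"
  by (subst integ_eqI[of "antideriv p + antideriv q"])
     (simp_all add: pderiv_add pderiv_antideriv integ_def)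

lemma integ_diff: "integ (p - q) = integ p - integ q"
  by (subst integ_eqI[of "antideriv p - antideriv q"])
     (simp_all add: pderiv_diff pderiv_antideriv integ_def)

lemma integ_smult: "integ (Polynomial.smult c p) = c * integ p"
  by (subst integ_eqI[of "Polynomial.smult c (antideriv p)"])
     (simp_all add: pderiv_smult pderiv_antideriv integ_def algebra_simps)

lemma integ_minus: "integ (- p) = - integ p"
  using integ_smult[of "-1" p] by simp

lemma integ_0: "integ 0 = 0"
  using integ_smult[of 0 0] by simp

lemma integ_sum: "integ (\<Sum>i\<in>A. f i) = (\<Sum>i\<in>A. integ (f i))"
  by (induction A rule: infinite_finite_induct) (simp_all add: integ_0 integ_add)

lemma integ_by_parts:
  "integ (p * pderiv q) = poly p 1 * poly q 1 - poly p (-1) * poly q (-1) - integ (pderiv p * q)"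
proof -
  have "integ (p * pderiv q + pderiv p * q) = poly (p * q) 1 - poly (p * q) (-1)"
    by (rule integ_eqI) (simp add: pderiv_mult algebra_simps)
  then show ?thesis by (simp add: integ_add)
qed

lemma integ_nonneg:
  assumes "\<And>x. -1 \<le> x \<Longrightarrow> x \<le> 1 \<Longrightarrow> 0 \<le> poly p x"
  shows "0 \<le> integ p"
proof -
  have "poly (antideriv p) (-1) \<le> poly (antideriv p) 1"
    by (rule DERIV_nonneg_imp_nondecreasing)
       (use assms poly_DERIV[of "antideriv p"] in \<open>auto simp: pderiv_antideriv\<close>)
  then show ?thesis by (simp add: integ_def)
qed

text \<open>Cauchy-Schwarz for \<open>u(x)\<close> as the integral of its derivative over [-1, x],
  an interval of length at most 2.\<close>

lemma poly_sq_le_integ_pderiv_sq: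
  assumes u: "poly u (-1) = 0" and x: "-1 < x" "x \<le> 1"
  shows "(poly u x)\<^sup>2 \<le> 2 * integ ((pderiv u)\<^sup>2)"
proof -
  define P where "P = antideriv ((pderiv u)\<^sup>2)"
  \<comment> \<open>The mean slope of \<open>u\<close> over [-1, x]. The polynomial \<open>F\<close>
    below has the derivative \<open>(u' - t)^2\<close>, so its growth over the interval expresses
    that this square has a nonnegative integral.\<close>
  define t where "t = poly u x / (x + 1)"
  define F where "F = P - Polynomial.smult (2 * t) u + [:0, t\<^sup>2:]"
  have dF: "poly (pderiv F) y = (poly (pderiv u) y - t)\<^sup>2" for y
    by (simp add: F_def P_def pderiv_add pderiv_diff pderiv_antideriv pderiv_smult
      pderiv_pCons power2_eq_square algebra_simps)
  have "poly F (-1) \<le> poly F x"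
  proof (rule DERIV_nonneg_imp_nondecreasing[where f = "poly F"])
    show "\<exists>d. (poly F has_real_derivative d) (at y) \<and> 0 \<le> d" for y
      using poly_DERIV[of F y] by (intro exI[of _ "poly (pderiv F) y"]) (simp add: dF)
  qed (use x in simp)
  then have "2 * t * poly u x \<le> poly P x - poly P (-1) + t\<^sup>2 * (x + 1)"
    using u by (simp add: F_def algebra_simps power2_eq_square)
  moreover have "t\<^sup>2 * (x + 1) = t * poly u x"
    using x by (simp add: t_def power2_eq_square)
  ultimately have "t * poly u x \<le> poly P x - poly P (-1)" by simp
  moreover have "poly P x \<le> poly P 1"
  proof (rule DERIV_nonneg_imp_nondecreasing[where f = "poly P"])
    show "\<exists>d. (poly P has_real_derivative d) (at y) \<and> 0 \<le> d" for y
      using poly_DERIV[of P y]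
      by (intro exI[of _ "poly (pderiv P) y"]) (simp add: P_def pderiv_antideriv)
  qed (use x in simp)
  ultimately have "t * poly u x \<le> integ ((pderiv u)\<^sup>2)"
    by (simp add: integ_def P_def)
  moreover have "(poly u x)\<^sup>2 = (x + 1) * (t * poly u x)"
    using x by (simp add: t_def power2_eq_square)
  moreover have "0 \<le> t * poly u x"
    using x by (simp add: t_def)
  ultimately show ?thesis using x
    by (metis add_mono mult_mono one_add_one order_refl zero_le_numeral)
qed

subsection \<open>Legendre polynomials\<close>

text \<open>One derivative removes one factor \<open>x - a\<close> and turns \<open>q\<close> into
  \<open>(n + 1) q + (x - a) q'\<close>, whose value at \<open>a\<close> is
  \<open>(n + 1) q(a)\<close>. Since \<open>q\<close> changes, the induction is general in
  it.\<close>

lemma poly_funpow_pderiv_root_power: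
  fixes q :: "real poly"
  shows "poly ((pderiv ^^ n) ([:- a, 1:] ^ n * q)) a = fact n * poly q a"
proof (induction n arbitrary: q)
  case (Suc n)
  have "pderiv ([:- a, 1:] ^ Suc n * q)
      = [:- a, 1:] ^ n * (of_nat (Suc n) * q + [:- a, 1:] * pderiv q)"
    unfolding pderiv_mult pderiv_power_Suc
    by (simp add: pderiv_pCons algebra_simps one_pCons of_nat_poly)
  then show ?case
    by (simp only: funpow_Suc_right o_apply Suc.IH) simp
qed simp

lemma poly_funpow_pderiv_root_power_less:
  fixes q :: "real poly"
  assumes "k < n"
  shows "poly ((pderiv ^^ k) ([:- a, 1:] ^ n * q)) a = 0"
  using assms
proof (induction k arbitrary: n q)
  case 0
  then show ?case by (simp add: zero_power)
next
  case (Suc k)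
  then obtain m where m: "n = Suc m" "k < m" by (cases n) auto
  have "pderiv ([:- a, 1:] ^ Suc m * q)
      = [:- a, 1:] ^ m * (of_nat (Suc m) * q + [:- a, 1:] * pderiv q)"
    unfolding pderiv_mult pderiv_power_Suc
    by (simp add: pderiv_pCons algebra_simps one_pCons of_nat_poly)
  then show ?case using m
    by (simp only: funpow_Suc_right o_apply Suc.IH)
qed

definition rodrigues :: "nat \<Rightarrow> real poly" where
  "rodrigues n = [:-1, 0, 1:] ^ n"

lemma rodrigues_factor: "rodrigues n = [:-1, 1:] ^ n * [:1, 1:] ^ n"
  by (simp add: rodrigues_def flip: power_mult_distrib)

lemma rodrigues_deriv_pm1:
  assumes "k < n"
  shows "poly ((pderiv ^^ k) (rodrigues n)) 1 = 0" "poly ((pderiv ^^ k) (rodrigues n)) (-1) = 0"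
  using poly_funpow_pderiv_root_power_less[OF assms, of 1 "[:1,1:]^n"]
    poly_funpow_pderiv_root_power_less[OF assms, of "-1" "[:-1,1:]^n"]
  by (simp_all add: rodrigues_factor mult.commute)

lemma degree_rodrigues: "degree (rodrigues n) = 2 * n"
  by (simp add: rodrigues_def degree_power_eq)

lemma degree_funpow_pderiv: "degree ((pderiv ^^ k) (p :: real poly)) = degree p - k"
  by (induction k) (simp_all add: degree_pderiv)

lemma legendre_poly_rodrigues:
  "legendre_poly n = Polynomial.smult (1 / (2 ^ n * fact n)) ((pderiv ^^ n) (rodrigues n))"
  by (simp add: legendre_poly_def rodrigues_def)

lemma degree_legendre [simp]: "degree (legendre_poly n) = n"
  by (simp add: legendre_poly_rodrigues degree_funpow_pderiv degree_rodrigues)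

lemma legendre_at_1 [simp]: "poly (legendre_poly n) 1 = 1"
  using poly_funpow_pderiv_root_power[of n 1 "[:1,1:]^n"]
  by (simp add: legendre_poly_rodrigues rodrigues_factor)

lemma legendre_at_minus1 [simp]: "poly (legendre_poly n) (-1) = (-1) ^ n"
proof -
  have "(-2::real) ^ n = (-1) ^ n * 2 ^ n"
    by (simp flip: power_mult_distrib)
  then show ?thesis
    using poly_funpow_pderiv_root_power[of n "-1" "[:-1,1:]^n"]
    by (simp add: legendre_poly_rodrigues rodrigues_factor mult.commute)
qed

lemma legendre_nonzero [simp]: "legendre_poly n \<noteq> 0"
  using legendre_at_1[of n] by force

text \<open>Integration by parts \<open>m\<close> times: the boundary terms vanish by the
  assumptions on \<open>F\<close>, and the \<open>m\<close>-th derivative of \<open>q\<close> is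
  zero.\<close>

lemma integ_mult_funpow_pderiv_eq_0:
  fixes q F :: "real poly"
  assumes "\<And>j. j < m \<Longrightarrow> poly ((pderiv ^^ j) F) 1 = 0"
    and "\<And>j. j < m \<Longrightarrow> poly ((pderiv ^^ j) F) (-1) = 0"
    and "degree q < m \<or> q = 0"
  shows "integ (q * (pderiv ^^ m) F) = 0"
  using assms
proof (induction m arbitrary: q)
  case 0
  then show ?case by (simp add: integ_0)
next
  case (Suc m)
  have "degree (pderiv q) < m \<or> pderiv q = 0"
    using Suc.prems(3) by (auto simp: degree_pderiv pderiv_eq_0_iff)
  then have "integ (pderiv q * (pderiv ^^ m) F) = 0"
    using Suc by simp
  then show ?case using Suc.prems(1,2)[of m] by (simp add: integ_by_parts)
qed

lemma legendre_orthogonal: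
  assumes "degree q < m \<or> q = 0"
  shows "integ (q * legendre_poly m) = 0"
  using integ_mult_funpow_pderiv_eq_0[OF _ _ assms, of "rodrigues m"] rodrigues_deriv_pm1[of _ m]
  by (simp add: legendre_poly_rodrigues integ_smult)

text \<open>Comes from differentiating \<open>(x^2 - 1) f' = 2 n x f\<close>, for
  \<open>f = (x^2 - 1)^n\<close>, a total of \<open>k + 1\<close> times. The case
  \<open>k = n\<close> is Legendre's equation.\<close>

lemma rodrigues_deriv_recurrence:
  "[:-1, 0, 1:] * (pderiv ^^ (k + 2)) (rodrigues n)
    = Polynomial.smult (2 * (real n - real k - 1)) ([:0, 1:] * (pderiv ^^ (k + 1)) (rodrigues n))
      + Polynomial.smult (real (k + 1) * (2 * real n - real k)) ((pderiv ^^ k) (rodrigues n))"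
proof (induction k)
  case 0
  have first: "[:-1, 0, 1:] * pderiv (rodrigues n) = Polynomial.smult (2 * real n) ([:0, 1:] * rodrigues n)"
  proof (cases n)
    case (Suc m)
    show ?thesis
      unfolding rodrigues_def Suc pderiv_power_Suc
      by (simp add: pderiv_pCons algebra_simps)
  qed (simp add: rodrigues_def pderiv_1)
  have "pderiv ([:-1, 0, 1:] * pderiv (rodrigues n))
      = pderiv (Polynomial.smult (2 * real n) ([:0, 1:] * rodrigues n))"
    by (simp only: first)
  then have "poly ([:-1, 0, 1:] * pderiv (pderiv (rodrigues n))) x
     = poly (Polynomial.smult (2 * (real n - 1)) ([:0, 1:] * pderiv (rodrigues n))
      + Polynomial.smult (2 * real n) (rodrigues n)) x" for x
    by (simp add: pderiv_rules poly_eq_poly_eq_iff[symmetric] fun_eq_iff)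
       (drule spec[of _ x], simp add: algebra_simps)
  then show ?case
    by (simp add: poly_eq_poly_eq_iff[symmetric] fun_eq_iff)
next
  case (Suc k)
  define f where "f = (pderiv ^^ k) (rodrigues n)"
  have f: "(pderiv ^^ Suc k) (rodrigues n) = pderiv f" "(pderiv ^^ (k + 1)) (rodrigues n) = pderiv f"
    "(pderiv ^^ (k + 2)) (rodrigues n) = pderiv (pderiv f)"
    "(pderiv ^^ (Suc k + 1)) (rodrigues n) = pderiv (pderiv f)"
    "(pderiv ^^ (Suc k + 2)) (rodrigues n) = pderiv (pderiv (pderiv f))"
    by (simp_all add: f_def)
  have "pderiv ([:-1, 0, 1:] * pderiv (pderiv f))
      = pderiv (Polynomial.smult (2 * (real n - real k - 1)) ([:0, 1:] * pderiv f)
      + Polynomial.smult (real (k + 1) * (2 * real n - real k)) f)"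
    using Suc unfolding f by (simp add: f_def)
  then have "poly ([:-1, 0, 1:] * pderiv (pderiv (pderiv f))) x
     = poly (Polynomial.smult (2 * (real n - real (Suc k) - 1)) ([:0, 1:] * pderiv (pderiv f))
      + Polynomial.smult (real (Suc k + 1) * (2 * real n - real (Suc k))) (pderiv f)) x" for x
    by (simp add: pderiv_rules poly_eq_poly_eq_iff[symmetric] fun_eq_iff)
       (drule spec[of _ x], simp add: algebra_simps)
  then show ?case unfolding f
    by (simp only: poly_eq_poly_eq_iff[symmetric] fun_eq_iff) simp
qed

section \<open>Legendre's differential equation and values at the end points\<close>

lemma legendre_ode:
  "(1 - x\<^sup>2) * poly (pderiv (pderiv (legendre_poly n))) x
    = 2 * x * poly (pderiv (legendre_poly n)) x - real n * (real n + 1) * poly (legendre_poly n) x"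
proof -
  define f where "f = (pderiv ^^ n) (rodrigues n)"
  define c where "c = (1 :: real) / (2 ^ n * fact n)"
  have L: "legendre_poly n = Polynomial.smult c f"
    by (simp add: legendre_poly_rodrigues f_def c_def)
  have "poly ([:-1, 0, 1:] * pderiv (pderiv f)) x
    = poly (Polynomial.smult (-2) ([:0, 1:] * pderiv f) + Polynomial.smult (real (n + 1) * real n) f) x"
    using rodrigues_deriv_recurrence[of n n] by (simp add: f_def)
  then have "(1 - x\<^sup>2) * poly (pderiv (pderiv f)) x = 2 * x * poly (pderiv f) x - real n * (real n + 1) * poly f x"
    by (simp add: algebra_simps power2_eq_square)
  then have "c * ((1 - x\<^sup>2) * poly (pderiv (pderiv f)) x) = c * (2 * x * poly (pderiv f) x - real n * (real n + 1) * poly f x)"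
    by simp
  then show ?thesis by (simp add: L pderiv_smult algebra_simps)
qed

lemma legendre_ode_pderiv:
  "pderiv ([:1, 0, -1:] * pderiv (legendre_poly n))
    = Polynomial.smult (- (real n * (real n + 1))) (legendre_poly n)"
  using legendre_ode[of _ n]
  by (simp add: poly_eq_poly_eq_iff[symmetric] fun_eq_iff pderiv_rules algebra_simps power2_eq_square)

text \<open>Legendre's equation differentiated once, as a second-order equation for L_n'. At 1 and
  -1 its left side vanishes; this gives L_n'' there and, in \<open>lgl_node_end_distance\<close>, a
  sum over the zeros of L_n'.\<close>

lemma legendre_ode_deriv:
  "(1 - x\<^sup>2) * poly (pderiv (pderiv (pderiv (legendre_poly n)))) x
    = 4 * x * poly (pderiv (pderiv (legendre_poly n))) x
      - (real n * (real n + 1) - 2) * poly (pderiv (legendre_poly n)) x"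
proof -
  have "poly (pderiv (pderiv ([:1, 0, -1:] * pderiv (legendre_poly n)))) x
    = poly (pderiv (Polynomial.smult (- (real n * (real n + 1))) (legendre_poly n))) x"
    by (simp only: legendre_ode_pderiv)
  then show ?thesis
    by (simp add: pderiv_rules algebra_simps power2_eq_square)
qed

lemma legendre_deriv_1:
  "poly (pderiv (legendre_poly n)) 1 = real n * (real n + 1) / 2"
  using legendre_ode[of 1 n] by simp

lemma legendre_deriv_minus1:
  "poly (pderiv (legendre_poly n)) (-1) = - ((-1) ^ n * (real n * (real n + 1)) / 2)"
  using legendre_ode[of "-1" n] by (simp add: field_simps)

lemma legendre_deriv2_1:
  "poly (pderiv (pderiv (legendre_poly n))) 1
    = (real n - 1) * real n * (real n + 1) * (real n + 2) / 8"
  using legendre_ode_deriv[of 1 n] by (simp add: legendre_deriv_1 field_simps)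

lemma legendre_deriv2_minus1:
  "poly (pderiv (pderiv (legendre_poly n))) (-1)
    = (-1) ^ n * ((real n - 1) * real n * (real n + 1) * (real n + 2) / 8)"
  using legendre_ode_deriv[of "-1" n] by (simp add: legendre_deriv_minus1 field_simps)

text \<open>\<open>r = x L' - n L\<close> has degree below \<open>n\<close> and is therefore
  orthogonal to \<open>L\<close>; this turns the integral of \<open>x L L'\<close> into
  \<open>n\<close> times that of \<open>L^2\<close>. Integrating the derivative of
  \<open>x L^2\<close> then gives a linear equation for the norm.\<close>

lemma legendre_norm: "(2 * real n + 1) * integ ((legendre_poly n)\<^sup>2) = 2"
proof -
  define L where "L = legendre_poly n"
  define r where "r = [:0, 1:] * pderiv L - Polynomial.smult (real n) L"
  have deg: "degree r \<le> n"
    unfolding r_def L_def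
    by (cases n) (auto intro!: degree_diff_le simp: degree_pCons_eq_if degree_pderiv pderiv_eq_0_iff)
  have "coeff r n = 0"
    by (cases n) (simp_all add: r_def coeff_pderiv)
  then have "degree r < n \<or> r = 0"
    using deg by (metis le_neq_implies_less leading_coeff_0_iff)
  then have "integ (r * L) = 0" by (simp add: legendre_orthogonal L_def)
  then have xL: "integ ([:0, 1:] * pderiv L * L) = real n * integ (L\<^sup>2)"
    by (simp add: r_def algebra_simps integ_diff integ_smult power2_eq_square)
  have "integ (L\<^sup>2 + ([:0, 1:] * pderiv L * L + [:0, 1:] * pderiv L * L)) = 2"
    by (subst integ_eqI[of "[:0, 1:] * L\<^sup>2"])
       (simp_all add: pderiv_mult pderiv_pCons power2_eq_square algebra_simps L_def
         flip: power_mult_distrib)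
  then show ?thesis
    by (simp only: integ_add xL) (simp add: L_def algebra_simps)
qed

text \<open>In two integrations by parts the factor 1 - x^2 removes the first boundary terms and
  orthogonality removes the last integral; only the derivative of \<open>P\<close> at the end points
  is left. So L_m'' represents a functional of end point values in the inner product with weight 1 -
  x^2, as needed in \<open>end_term_bound\<close>.\<close>

lemma integ_weight_legendre_deriv2:
  assumes "degree p < m \<or> p = 0"
  shows "integ ([:1, 0, -1:] * p * pderiv (pderiv (legendre_poly m)))
    = 2 * poly p 1 + 2 * (-1) ^ m * poly p (-1)"
proof -
  define L where "L = legendre_poly m"
  define P where "P = [:1, 0, -1:] * p"
  have "degree (pderiv (pderiv P)) < m \<or> pderiv (pderiv P) = 0"
  proof (cases "p = 0")
    case False
    then have "degree P = degree [:1, 0, -1 :: real:] + degree p"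
      unfolding P_def by (intro degree_mult_eq) simp_all
    then show ?thesis using assms False by (simp add: degree_pderiv)
  qed (simp add: P_def)
  then have 0: "integ (pderiv (pderiv P) * L) = 0" by (simp add: L_def legendre_orthogonal)
  have "integ (P * pderiv (pderiv L)) = - integ (pderiv P * pderiv L)"
    by (simp add: integ_by_parts P_def)
  also have "\<dots> = - (poly (pderiv P) 1 * poly L 1 - poly (pderiv P) (-1) * poly L (-1))"
    by (simp add: integ_by_parts 0)
  finally show ?thesis
    by (simp add: P_def L_def pderiv_rules)
qed

subsection \<open>Legendre-Gauss-Lobatto nodes\<close>

text \<open>Rolle's theorem, one derivative at a time: for \<open>k < n\<close> the end points are
  zeros of the \<open>k\<close>-th derivative too, so \<open>k\<close> inner zeros make
  \<open>k + 2\<close> zeros in all and give \<open>k + 1\<close> inner zeros of the next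
  derivative.\<close>

lemma rodrigues_deriv_roots:
  assumes "k \<le> n"
  shows "\<exists>f::nat \<Rightarrow> real.
    (\<forall>i<k. -1 < f i \<and> f i < 1 \<and> poly ((pderiv ^^ k) (rodrigues n)) (f i) = 0) \<and>
    (\<forall>i. Suc i < k \<longrightarrow> f i < f (Suc i))"
  using assms
proof (induction k)
  case 0
  show ?case by simp
next
  case (Suc k)
  let ?p = "(pderiv ^^ k) (rodrigues n)"
  from Suc obtain f where f: "\<And>i. i < k \<Longrightarrow> -1 < f i \<and> f i < 1 \<and> poly ?p (f i) = 0"
    and mono: "\<And>i. Suc i < k \<Longrightarrow> f i < f (Suc i)" by auto
  define F where "F i = (if i = 0 then -1 else if i = Suc k then 1 else f (i - 1))" for i
  have F_less: "F i < F (Suc i)" if "i \<le> k" for i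
  proof (cases i)
    case 0
    then show ?thesis using f[of 0] by (auto simp: F_def)
  next
    case (Suc m)
    then show ?thesis using that f[of m] mono[of m] by (auto simp: F_def)
  qed
  have F_ge: "-1 \<le> F i" and F_le: "F i \<le> 1" and F_root: "poly ?p (F i) = 0" if "i \<le> Suc k" for i
    using that f[of "i - 1"] rodrigues_deriv_pm1[of k n] Suc.prems
    by (auto simp: F_def not_le intro: less_imp_le)
  have "\<forall>i. \<exists>z. i \<le> k \<longrightarrow> F i < z \<and> z < F (Suc i) \<and> poly (pderiv ?p) z = 0"
  proof
    fix i
    show "\<exists>z. i \<le> k \<longrightarrow> F i < z \<and> z < F (Suc i) \<and> poly (pderiv ?p) z = 0"
    proof (cases "i \<le> k")
      case True
      then obtain z where "F i < z" "z < F (Suc i)"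
        "poly ?p (F (Suc i)) - poly ?p (F i) = (F (Suc i) - F i) * poly (pderiv ?p) z"
        using poly_MVT[OF F_less[OF True]] by blast
      then show ?thesis using F_root[of i] F_root[of "Suc i"] True F_less[OF True] by auto
    qed simp
  qed
  then obtain g where g: "\<And>i. i \<le> k \<Longrightarrow> F i < g i \<and> g i < F (Suc i) \<and> poly (pderiv ?p) (g i) = 0"
    by metis
  show ?case
  proof (intro exI[of _ g] conjI allI impI)
    fix i assume "i < Suc k"
    then show "-1 < g i" "g i < 1" "poly ((pderiv ^^ Suc k) (rodrigues n)) (g i) = 0"
      using g[of i] F_ge[of i] F_le[of "Suc i"] by auto
  next
    fix i assume "Suc i < Suc k"
    then show "g i < g (Suc i)" using g[of i] g[of "Suc i"] by auto
  qed
qed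

lemma degree_pderiv_legendre [simp]: "degree (pderiv (legendre_poly n)) = n - 1"
  by (simp add: degree_pderiv)

lemma pderiv_legendre_nonzero: "1 \<le> n \<Longrightarrow> pderiv (legendre_poly n) \<noteq> 0"
  by (simp add: pderiv_eq_0_iff)

text \<open>Rolle's theorem between the \<open>n\<close> zeros of L_n yields \<open>n - 1\<close>
  zeros inside (-1, 1), and the degree leaves room for no others.\<close>

lemma legendre_deriv_roots:
  assumes n: "1 \<le> n"
  shows "finite {x. poly (pderiv (legendre_poly n)) x = 0}"
    and "card {x. poly (pderiv (legendre_poly n)) x = 0} = n - 1"
    and "{x. poly (pderiv (legendre_poly n)) x = 0} \<subseteq> {-1<..<1}"
proof -
  let ?L = "legendre_poly n"
  let ?R = "{x. poly (pderiv ?L) x = 0}"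
  show fin: "finite ?R"
    by (rule poly_roots_finite) (rule pderiv_legendre_nonzero[OF n])
  obtain f where f: "\<And>i. i < n \<Longrightarrow> -1 < f i \<and> f i < 1 \<and> poly ?L (f i) = 0"
    and mono: "\<And>i. Suc i < n \<Longrightarrow> f i < f (Suc i)"
    using rodrigues_deriv_roots[of n n] by (auto simp: legendre_poly_rodrigues)
  have "\<exists>z. Suc i < n \<longrightarrow> f i < z \<and> z < f (Suc i) \<and> poly (pderiv ?L) z = 0" for i
  proof (cases "Suc i < n")
    case True
    then obtain z where "f i < z" "z < f (Suc i)"
      "poly ?L (f (Suc i)) - poly ?L (f i) = (f (Suc i) - f i) * poly (pderiv ?L) z"
      using poly_MVT[OF mono[OF True]] by blast
    then show ?thesis using f[of i] f[of "Suc i"] True mono[OF True] by auto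
  qed simp
  then obtain g where g: "\<And>i. Suc i < n \<Longrightarrow> f i < g i \<and> g i < f (Suc i) \<and> poly (pderiv ?L) (g i) = 0"
    by metis
  have step: "g i < g (Suc i)" if "Suc i < n - 1" for i
    using g[of i] g[of "Suc i"] that less_trans[of "g i" "f (Suc i)" "g (Suc i)"] by simp
  have "g i < g j" if "i < j" "j < n - 1" for i j
    using that
  proof (induction j)
    case (Suc j)
    then show ?case using step[of j] by (cases "i = j") auto
  qed simp
  then have "inj_on g {..<n - 1}"
    by (intro linorder_inj_onI) (auto simp: less_imp_neq)
  then have "card (g ` {..<n - 1}) = n - 1"
    by (simp add: card_image)
  moreover have g_in: "g ` {..<n - 1} \<subseteq> ?R \<inter> {-1<..<1}"
  proof
    fix x assume "x \<in> g ` {..<n - 1}"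
    then obtain i where "i < n - 1" and x: "x = g i" by auto
    then show "x \<in> ?R \<inter> {-1<..<1}" unfolding x
      using g[of i] f[of i] f[of "Suc i"] less_trans[of "-1" "f i" "g i"]
        less_trans[of "g i" "f (Suc i)" 1] by simp
  qed
  ultimately have ge: "n - 1 \<le> card (?R \<inter> {-1<..<1})"
    using fin by (metis card_mono finite_Int)
  have le: "card ?R \<le> n - 1"
    using card_poly_roots_bound[OF pderiv_legendre_nonzero[OF n]] by simp
  have "card (?R \<inter> {-1<..<1}) \<le> card ?R"
    using fin by (simp add: card_mono)
  then show "card ?R = n - 1" using ge le by linarith
  have "?R \<inter> {-1<..<1} = ?R"
    using fin ge le by (intro card_seteq) auto
  then show "?R \<subseteq> {-1<..<1}" by blast
qed

abbreviation omega :: "real poly" where "omega \<equiv> [:1, 0, -1:]"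

definition lgl_set :: "nat \<Rightarrow> real set" where
  "lgl_set N = {x. poly (omega * pderiv (legendre_poly N)) x = 0}"

lemma lgl_set_eq:
  "lgl_set N = insert (-1) (insert 1 {x. poly (pderiv (legendre_poly N)) x = 0})"
proof -
  have "1 - x * x = 0 \<longleftrightarrow> x = 1 \<or> x = -1" for x :: real
    using square_eq_1_iff[of x] by auto
  then show ?thesis by (auto simp: lgl_set_def simp flip: poly_mult)
qed

lemma
  assumes N: "1 \<le> N"
  shows finite_lgl_set: "finite (lgl_set N)"
    and card_lgl_set: "card (lgl_set N) = N + 1"
    and lgl_set_subset: "lgl_set N \<subseteq> {-1..1}"
proof -
  have "1 \<notin> {x. poly (pderiv (legendre_poly N)) x = 0}"
    "-1 \<notin> {x. poly (pderiv (legendre_poly N)) x = 0}"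
    using legendre_deriv_roots(3)[OF N] by auto
  then show "finite (lgl_set N)" "card (lgl_set N) = N + 1" "lgl_set N \<subseteq> {-1..1}"
    using legendre_deriv_roots[OF N] N by (auto simp: lgl_set_eq subset_iff less_imp_le)
qed

section \<open>Enumeration of the nodes\<close>

lemma lgl_node_altdef: "lgl_node N i = sorted_list_of_set (lgl_set N) ! i"
  by (simp only: lgl_node_def lgl_set_def)

lemma lgl_node_less:
  assumes "1 \<le> N" "i < j" "j \<le> N"
  shows "lgl_node N i < lgl_node N j"
  using assms sorted_list_of_set.strict_sorted_key_list_of_set[of "lgl_set N"]
    card_lgl_set[OF assms(1)]
  by (auto simp: lgl_node_altdef sorted_wrt_iff_nth_less)

lemma lgl_node_image:
  assumes "1 \<le> N"
  shows "lgl_node N ` {..N} = lgl_set N"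
proof -
  have "set (sorted_list_of_set (lgl_set N)) = lgl_set N"
    using finite_lgl_set[OF assms] by simp
  moreover have "length (sorted_list_of_set (lgl_set N)) = Suc N"
    using card_lgl_set[OF assms] by simp
  ultimately show ?thesis
    by (auto simp: lgl_node_altdef set_conv_nth image_iff less_Suc_eq_le)
qed

lemma inj_lgl_node:
  assumes "1 \<le> N"
  shows "inj_on (lgl_node N) {..N}"
  using lgl_node_less[OF assms] by (intro linorder_inj_onI) (auto simp: less_imp_neq)

lemma lgl_node_bounds:
  assumes "1 \<le> N" "i \<le> N"
  shows "-1 \<le> lgl_node N i" "lgl_node N i \<le> 1"
  using lgl_node_image[OF assms(1)] lgl_set_subset[OF assms(1)] assms(2) by force+

lemma lgl_node_0:
  assumes "1 \<le> N"
  shows "lgl_node N 0 = -1"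
proof -
  obtain i where "i \<le> N" "lgl_node N i = -1"
    using lgl_node_image[OF assms] lgl_set_eq[of N] by (metis atMost_iff imageE insertI1)
  then show ?thesis
    using lgl_node_less[OF assms, of 0 i] lgl_node_bounds[OF assms, of 0] by (cases "i = 0") auto
qed

lemma lgl_node_N:
  assumes "1 \<le> N"
  shows "lgl_node N N = 1"
proof -
  obtain i where "i \<le> N" "lgl_node N i = 1"
    using lgl_node_image[OF assms] lgl_set_eq[of N] by (metis atMost_iff imageE insertI1 insertI2)
  then show ?thesis
    using lgl_node_less[OF assms, of i N] lgl_node_bounds[OF assms, of N] by (cases "i = N") auto
qed

lemma lgl_node_interior:
  assumes "1 \<le> i" "i < N"
  shows "-1 < lgl_node N i" "lgl_node N i < 1" "poly (pderiv (legendre_poly N)) (lgl_node N i) = 0"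
proof -
  have N: "1 \<le> N" using assms by simp
  show *: "-1 < lgl_node N i" "lgl_node N i < 1"
    using lgl_node_less[OF N, of 0 i] lgl_node_less[OF N, of i N] assms
    by (simp_all add: lgl_node_0[OF N] lgl_node_N[OF N])
  have "lgl_node N i \<in> lgl_set N"
    using lgl_node_image[OF N] assms by auto
  then show "poly (pderiv (legendre_poly N)) (lgl_node N i) = 0"
    using * by (simp add: lgl_set_eq)
qed

subsection \<open>Lagrange interpolation\<close>

lemma poly_eq_if_agree_on_nodes:
  fixes p q :: "real poly"
  assumes inj: "inj_on x {..N}" and deg: "degree p \<le> N" "degree q \<le> N"
    and eq: "\<And>i. i \<le> N \<Longrightarrow> poly p (x i) = poly q (x i)"
  shows "p = q"
proof (rule ccontr)
  assume "p \<noteq> q"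
  then have nz: "p - q \<noteq> 0" by simp
  have "Suc N = card (x ` {..N})" using inj by (simp add: card_image)
  also have "\<dots> \<le> card {y. poly (p - q) y = 0}"
    using eq by (intro card_mono poly_roots_finite nz) auto
  also have "\<dots> \<le> degree (p - q)" by (rule card_poly_roots_bound[OF nz])
  also have "\<dots> \<le> N" using deg by (rule degree_diff_le)
  finally show False by simp
qed

text \<open>The usual product has both properties, and a polynomial of degree at most
  \<open>N\<close> is determined by its values at the \<open>N + 1\<close> distinct nodes; hence the
  definite description in \<open>lagrange_basis\<close> denotes this product.\<close>

lemma lagrange_basis_spec:
  assumes N: "1 \<le> N" and j: "j \<le> N"
  shows "degree (lagrange_basis N j) \<le> N"
    and "\<And>i. i \<le> N \<Longrightarrow> poly (lagrange_basis N j) (lgl_node N i) = (if i = j then 1 else 0)"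
proof -
  let ?P = "\<lambda>p. degree p \<le> N \<and> (\<forall>i\<le>N. poly p (lgl_node N i) = (if i = j then 1 else 0))"
  define l where "l = (\<Prod>i\<in>{..N} - {j}.
    Polynomial.smult (1 / (lgl_node N j - lgl_node N i)) [:- lgl_node N i, 1:])"
  have ne: "lgl_node N j \<noteq> lgl_node N i" if "i \<in> {..N} - {j}" for i
    using inj_lgl_node[OF N] j that by (auto dest: inj_onD)
  have "degree l \<le> (\<Sum>i\<in>{..N} - {j}. 1)"
    unfolding l_def
    by (rule order.trans[OF degree_prod_sum_le], simp)
       (intro sum_mono, simp add: degree_pCons_0)
  then have "degree l \<le> N" using j by simp
  moreover have "poly l (lgl_node N i) = (if i = j then 1 else 0)" if "i \<le> N" for i
  proof -
    have "poly l (lgl_node N i)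
        = (\<Prod>k\<in>{..N} - {j}. (lgl_node N i - lgl_node N k) / (lgl_node N j - lgl_node N k))"
      by (simp add: l_def poly_prod diff_divide_distrib)
    then show ?thesis using that ne by (auto intro!: prod.neutral)
  qed
  ultimately have "?P l" by simp
  moreover have "p = l" if "?P p" for p
    using that \<open>?P l\<close> by (intro poly_eq_if_agree_on_nodes[OF inj_lgl_node[OF N]]) auto
  ultimately have "?P (lagrange_basis N j)"
    unfolding lagrange_basis_def by (rule theI)
  then show "degree (lagrange_basis N j) \<le> N"
    "\<And>i. i \<le> N \<Longrightarrow> poly (lagrange_basis N j) (lgl_node N i) = (if i = j then 1 else 0)"
    by auto
qed

lemma lagrange_expansion:
  assumes N: "1 \<le> N" and p: "degree p \<le> N"
  shows "p = (\<Sum>j\<le>N. Polynomial.smult (poly p (lgl_node N j)) (lagrange_basis N j))"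
proof (rule poly_eq_if_agree_on_nodes[OF inj_lgl_node[OF N] p])
  show "degree (\<Sum>j\<le>N. Polynomial.smult (poly p (lgl_node N j)) (lagrange_basis N j)) \<le> N"
    by (intro degree_sum_le) (auto intro: order.trans[OF degree_smult_le] lagrange_basis_spec(1)[OF N])
  show "poly p (lgl_node N i) =
      poly (\<Sum>j\<le>N. Polynomial.smult (poly p (lgl_node N j)) (lagrange_basis N j)) (lgl_node N i)"
    if "i \<le> N" for i
    using that by (simp add: poly_sum lagrange_basis_spec(2)[OF N] if_distrib cong: if_cong)
qed

subsection \<open>Legendre-Gauss-Lobatto quadrature\<close>

definition lgl_weight :: "nat \<Rightarrow> nat \<Rightarrow> real" where
  "lgl_weight N i = integ (lagrange_basis N i)"

lemma degree_omega_legendre: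
  assumes "1 \<le> N"
  shows "degree (omega * pderiv (legendre_poly N)) = N + 1"
proof -
  have "degree (omega * pderiv (legendre_poly N)) = degree omega + degree (pderiv (legendre_poly N))"
    by (intro degree_mult_eq pderiv_legendre_nonzero[OF assms]) simp
  then show ?thesis using assms by simp
qed

text \<open>Integration by parts moves the derivative onto \<open>omega * q\<close>, and the result
  has degree below \<open>N\<close>; the factor \<open>omega\<close> kills the boundary
  terms.\<close>

lemma integ_omega_legendre_eq_0:
  assumes "degree q + 1 < N \<or> q = 0"
  shows "integ (q * (omega * pderiv (legendre_poly N))) = 0"
proof (cases "q = 0")
  case False
  have "degree (omega * q) = degree omega + degree q"
    using False by (intro degree_mult_eq) simp_all
  then have "degree (pderiv (omega * q)) < N"
    using assms False by (simp add: degree_pderiv)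
  then have "integ (pderiv (omega * q) * legendre_poly N) = 0"
    by (simp add: legendre_orthogonal)
  moreover have "integ ((omega * q) * pderiv (legendre_poly N))
    = - integ (pderiv (omega * q) * legendre_poly N)"
    by (subst integ_by_parts) simp
  ultimately show ?thesis by (simp only: mult.left_commute[of q] mult.assoc minus_zero)
qed (simp add: integ_0)

text \<open>Divide \<open>p\<close> by the nodal polynomial \<open>d\<close> of degree
  \<open>N + 1\<close>. The quotient is zero or of degree at most \<open>N - 2\<close>, so
  \<open>q * d\<close> integrates to zero, and it vanishes at the nodes; the remainder is
  interpolated exactly.\<close>

lemma lgl_quadrature:
  assumes N: "1 \<le> N" and p: "degree p \<le> 2 * N - 1"
  shows "integ p = (\<Sum>i\<le>N. lgl_weight N i * poly p (lgl_node N i))"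
proof -
  define d where "d = omega * pderiv (legendre_poly N)"
  define q where "q = p div d"
  define r where "r = p mod d"
  have pd: "p = q * d + r" by (simp add: q_def r_def)
  have dd: "degree d = N + 1" by (simp add: d_def degree_omega_legendre[OF N] del: mult_pCons_left)
  then have d0: "d \<noteq> 0" by auto
  then have r: "degree r \<le> N"
    using degree_mod_less[of d p] dd by (auto simp: r_def)
  have "degree q + 1 < N \<or> q = 0"
  proof (cases "q = 0")
    case False
    have "q * d = p - r" by (simp add: pd)
    then have "degree q + (N + 1) \<le> max (degree p) (degree r)"
      using degree_mult_eq[OF False d0] degree_diff_le_max[of p r] dd by simp
    then show ?thesis using p r N by (auto simp: max_def split: if_splits)
  qed simp
  then have 1: "integ (q * d) = 0" unfolding d_def by (rule integ_omega_legendre_eq_0)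
  have d_node: "poly d (lgl_node N i) = 0" if "i \<le> N" for i
    using lgl_node_image[OF N] that by (auto simp: d_def lgl_set_def)
  have "integ p = integ r" by (subst pd) (simp add: integ_add 1)
  also have "\<dots> = (\<Sum>i\<le>N. lgl_weight N i * poly r (lgl_node N i))"
    by (subst lagrange_expansion[OF N r])
       (simp add: integ_sum integ_smult lgl_weight_def mult.commute)
  also have "\<dots> = (\<Sum>i\<le>N. lgl_weight N i * poly p (lgl_node N i))"
    by (rule sum.cong) (simp_all add: pd d_node)
  finally show ?thesis .
qed

text \<open>The polynomial \<open>g\<close> vanishes at all nodes except possibly \<open>a\<close>,
  so the quadrature rule applied to it isolates one weight, while its integral is known from
  \<open>legendre_norm\<close>.\<close>

lemma lgl_weight_eq:
  assumes N: "1 \<le> N" and i: "i \<le> N"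
  shows "real N * (real N + 1) * lgl_weight N i * (poly (legendre_poly N) (lgl_node N i))\<^sup>2 = 2"
proof -
  define L where "L = legendre_poly N"
  define d where "d = omega * pderiv L"
  define a where "a = lgl_node N i"
  define k where "k = lead_coeff L"
  have dd: "degree d = N + 1" by (simp add: d_def L_def degree_omega_legendre[OF N] del: mult_pCons_left)
  have d_node: "poly d (lgl_node N j) = 0" if "j \<le> N" for j
    using lgl_node_image[OF N] that by (auto simp: d_def L_def lgl_set_def)
  obtain h where h: "d = [:- a, 1:] * h"
    using d_node[OF i] by (auto simp: a_def poly_eq_0_iff_dvd elim: dvdE)
  have h0: "h \<noteq> 0" using h dd by auto
  have "degree d = degree [:- a, 1:] + degree h"
    unfolding h by (intro degree_mult_eq h0) simp
  then have dh: "degree h = N" using dd by simp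
  have L_lead: "coeff L N = k" by (simp add: k_def L_def)
  have "lead_coeff (pderiv L) = real N * k"
    using N by (simp add: L_def k_def coeff_pderiv)
  then have "lead_coeff d = - (real N * k)"
    unfolding d_def lead_coeff_mult by simp
  then have lh: "lead_coeff h = - (real N * k)"
    unfolding h lead_coeff_mult by simp
  \<comment> \<open>\<open>h\<close> is the nodal polynomial without its factor at \<open>a\<close>.
    The product \<open>h * L\<close> has degree \<open>2 * N\<close>, one too many for the
    quadrature rule; the subtracted term vanishes at the nodes and cancels the leading
    coefficient.\<close>
  define g where "g = h * L - Polynomial.smult (1 / real N) (d * pderiv L)"
  have "coeff (h * L) (2 * N) = - (real N * k) * k"
    using coeff_mult_degree_sum[of h L] lh dh by (simp add: k_def L_def mult_2)
  moreover have "coeff (d * pderiv L) (2 * N) = - (real N * k) * (real N * k)"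
    using coeff_mult_degree_sum[of d "pderiv L"] dd N \<open>lead_coeff d = _\<close> \<open>lead_coeff (pderiv L) = _\<close>
    by (simp add: L_def mult_2)
  ultimately have c: "coeff g (2 * N) = 0"
    using N by (simp add: g_def)
  have "degree (h * L) \<le> 2 * N"
    using degree_mult_le[of h L] dh by (simp add: L_def)
  moreover have "degree (d * pderiv L) \<le> 2 * N"
    using degree_mult_le[of d "pderiv L"] dd N by (simp add: L_def)
  ultimately have "degree g \<le> 2 * N"
    unfolding g_def by (intro degree_diff_le order.trans[OF degree_smult_le])
  with c have deg: "degree g \<le> 2 * N - 1"
    using N leading_coeff_0_iff[of g] by (cases "degree g = 2 * N") auto
  have pd: "pderiv d = Polynomial.smult (- (real N * (real N + 1))) L"
    unfolding d_def L_def by (rule legendre_ode_pderiv)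
  have I1: "integ (d * pderiv L) = real N * (real N + 1) * integ (L\<^sup>2)"
    unfolding integ_by_parts pd by (simp add: d_def integ_smult power2_eq_square integ_minus)
  \<comment> \<open>The leading coefficient of \<open>h\<close> is \<open>- N\<close> times that of
    \<open>L\<close>, so orthogonality permits replacing \<open>h\<close> by \<open>- N L\<close> in
    the integral of \<open>h * L\<close>.\<close>
  have "degree (h + Polynomial.smult (real N) L) < N \<or> h + Polynomial.smult (real N) L = 0"
  proof -
    have "degree (h + Polynomial.smult (real N) L) \<le> N"
      by (intro degree_add_le) (simp_all add: dh L_def)
    moreover have "coeff (h + Polynomial.smult (real N) L) N = 0"
      using lh dh L_lead by simp
    ultimately show ?thesis by (metis le_neq_implies_less leading_coeff_0_iff)
  qed
  then have "integ ((h + Polynomial.smult (real N) L) * L) = 0"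
    unfolding L_def by (rule legendre_orthogonal)
  then have I2: "integ (h * L) = - (real N * integ (L\<^sup>2))"
    by (simp add: algebra_simps integ_add integ_smult power2_eq_square)
  have "integ g = - ((2 * real N + 1) * integ (L\<^sup>2))"
    unfolding g_def integ_diff integ_smult I1 I2 using N by (simp add: field_simps)
  then have g2: "integ g = -2" using legendre_norm[of N] by (simp add: L_def)
  have val: "poly g (lgl_node N j) = (if j = i then poly h a * poly L a else 0)" if "j \<le> N" for j
  proof -
    have "poly g (lgl_node N j) = poly h (lgl_node N j) * poly L (lgl_node N j)"
      by (simp add: g_def d_node[OF that])
    moreover have "poly h (lgl_node N j) = 0" if "j \<noteq> i"
    proof -
      have "lgl_node N j \<noteq> a"
        using inj_lgl_node[OF N] i \<open>j \<le> N\<close> that by (auto simp: a_def dest: inj_onD)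
      then show ?thesis using d_node[OF \<open>j \<le> N\<close>] by (simp add: h)
    qed
    ultimately show ?thesis by (simp add: a_def)
  qed
  \<comment> \<open>The derivative of \<open>(x - a) h\<close> at \<open>a\<close> is
    \<open>h(a)\<close>, and Legendre's equation supplies the derivative of
    \<open>d\<close>.\<close>
  have ha: "poly h a = - (real N * (real N + 1) * poly L a)"
  proof -
    have "poly (pderiv d) a = poly h a" by (simp add: h pderiv_rules)
    then show ?thesis by (simp add: pd)
  qed
  have "integ g = (\<Sum>j\<le>N. if j = i then lgl_weight N i * (poly h a * poly L a) else 0)"
    unfolding lgl_quadrature[OF N deg] by (rule sum.cong) (auto simp: val)
  also have "\<dots> = lgl_weight N i * (poly h a * poly L a)"
    using i by simp
  finally show ?thesis
    unfolding g2 ha by (simp add: L_def a_def power2_eq_square algebra_simps)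
qed

subsection \<open>Distance of the nodes to the end points\<close>

lemma poly_eq_prod_roots:
  fixes p :: "real poly"
  assumes "p \<noteq> 0" and "card {x. poly p x = 0} = degree p"
  shows "p = Polynomial.smult (lead_coeff p) (\<Prod>r\<in>{x. poly p x = 0}. [:- r, 1:])"
proof (rule ccontr)
  define R where "R = {x. poly p x = 0}"
  define m where "m = (\<Prod>r\<in>R. [:- r, 1:])"
  define q where "q = p - Polynomial.smult (lead_coeff p) m"
  assume "p \<noteq> Polynomial.smult (lead_coeff p) (\<Prod>r\<in>{x. poly p x = 0}. [:- r, 1:])"
  then have q0: "q \<noteq> 0" by (simp add: q_def m_def R_def)
  have fin: "finite R" unfolding R_def by (rule poly_roots_finite[OF assms(1)])
  have dm: "degree m = degree p"
    unfolding m_def by (subst degree_prod_eq_sum_degree) (use assms(2) in \<open>auto simp: R_def\<close>)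
  have "lead_coeff m = 1"
    unfolding m_def lead_coeff_prod by simp
  then have c: "coeff q (degree p) = 0" by (simp add: q_def dm)
  have "degree q \<le> degree p"
    unfolding q_def using dm by (intro degree_diff_le) simp_all
  with c q0 have "degree q < degree p"
    by (metis le_neq_implies_less leading_coeff_0_iff)
  moreover have "poly q r = 0" if "r \<in> R" for r
    using that fin by (auto simp: q_def m_def poly_prod R_def)
  then have "card R \<le> card {x. poly q x = 0}"
    by (intro card_mono poly_roots_finite q0) auto
  ultimately show False
    using card_poly_roots_bound[OF q0] assms(2) by (simp add: R_def)
qed

lemma poly_log_derivative:
  fixes p :: "real poly"
  assumes "p \<noteq> 0" and "card {x. poly p x = 0} = degree p" and c: "poly p c \<noteq> 0"
  shows "poly (pderiv p) c = poly p c * (\<Sum>r\<in>{x. poly p x = 0}. 1 / (c - r))"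
proof -
  define R where "R = {x. poly p x = 0}"
  have fin: "finite R" unfolding R_def by (rule poly_roots_finite[OF assms(1)])
  have p: "p = Polynomial.smult (lead_coeff p) (\<Prod>r\<in>R. [:- r, 1:])"
    using poly_eq_prod_roots[OF assms(1,2)] by (simp add: R_def)
  have ne: "c - r \<noteq> 0" if "r \<in> R" for r using that c by (auto simp: R_def)
  have 1: "(\<Prod>s\<in>R - {r}. c - s) = (\<Prod>s\<in>R. c - s) * (1 / (c - r))" if "r \<in> R" for r
    using prod.remove[OF fin that, of "\<lambda>s. c - s"] ne[OF that] by simp
  have "poly (pderiv p) c = lead_coeff p * (\<Sum>r\<in>R. \<Prod>s\<in>R - {r}. c - s)"
    by (subst p) (simp add: pderiv_smult pderiv_prod poly_sum poly_prod pderiv_pCons)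
  also have "\<dots> = lead_coeff p * ((\<Prod>s\<in>R. c - s) * (\<Sum>r\<in>R. 1 / (c - r)))"
    by (simp only: 1 sum_distrib_left cong: sum.cong)
  also have "\<dots> = poly p c * (\<Sum>r\<in>R. 1 / (c - r))"
    by (subst (2) p) (simp add: poly_prod)
  finally show ?thesis by (simp add: R_def)
qed

text \<open>For \<open>p = L_N'\<close> the differentiated Legendre equation at 1 says that p'/p
  equals \<open>(N (N + 1) - 2) / 4\<close> there, and p'/p is the sum of \<open>1 / (1 - r)\<close>
  over the zeros \<open>r\<close> of \<open>p\<close>. All terms are positive, so each one is
  bounded by the sum. The end point -1 is treated alike.\<close>

lemma lgl_node_end_distance:
  assumes i: "1 \<le> i" "i < N"
  defines "x \<equiv> lgl_node N i"
  shows "4 \<le> (real N * (real N + 1) - 2) * (1 - x)" "4 \<le> (real N * (real N + 1) - 2) * (1 + x)"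
proof -
  define p where "p = pderiv (legendre_poly N)"
  define R where "R = {x. poly p x = 0}"
  have N: "1 \<le> N" using i by simp
  note roots = legendre_deriv_roots[OF N, folded p_def, folded R_def]
  have p0: "p \<noteq> 0" using pderiv_legendre_nonzero[OF N] by (simp add: p_def)
  have card: "card {x. poly p x = 0} = degree p" using roots(2) by (simp add: p_def R_def)
  have xR: "x \<in> R" using lgl_node_interior(3)[OF i] by (simp add: R_def p_def x_def)
  have bounds: "-1 < r" "r < 1" if "r \<in> R" for r using roots(3) that by auto
  have p1: "poly p 1 \<noteq> 0" and p1': "poly p (-1) \<noteq> 0"
    using N by (simp_all add: p_def legendre_deriv_1 legendre_deriv_minus1)
  have "4 * poly (pderiv p) 1 = (real N * (real N + 1) - 2) * poly p 1"
    using legendre_ode_deriv[of 1 N] by (simp add: p_def)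
  then have s1: "(real N * (real N + 1) - 2) = 4 * (\<Sum>r\<in>R. 1 / (1 - r))"
    using p1 by (simp add: poly_log_derivative[OF p0 card p1] R_def)
  have "1 / (1 - x) \<le> (\<Sum>r\<in>R. 1 / (1 - r))"
    using bounds by (intro member_le_sum xR roots(1)) (simp add: less_imp_le)
  then have "1 \<le> (\<Sum>r\<in>R. 1 / (1 - r)) * (1 - x)"
    using bounds[OF xR] by (simp add: field_simps)
  then show "4 \<le> (real N * (real N + 1) - 2) * (1 - x)" by (simp add: s1)
  have "- 4 * poly (pderiv p) (-1) = (real N * (real N + 1) - 2) * poly p (-1)"
    using legendre_ode_deriv[of "-1" N] by (simp add: p_def)
  then have s2: "(real N * (real N + 1) - 2) = - 4 * (\<Sum>r\<in>R. 1 / (-1 - r))"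
  proof -
    have "poly p (-1) * (real N * (real N + 1) - 2) = poly p (-1) * (- 4 * (\<Sum>r\<in>R. 1 / (-1 - r)))"
      using \<open>- 4 * poly (pderiv p) (-1) = _\<close>
      unfolding poly_log_derivative[OF p0 card p1'] R_def by (simp add: mult.commute)
    then show ?thesis by (rule mult_left_cancel[OF p1', THEN iffD1])
  qed
  have s3: "(\<Sum>r\<in>R. 1 / (-1 - r)) = - (\<Sum>r\<in>R. 1 / (1 + r))"
    unfolding sum_negf[symmetric]
  proof (rule sum.cong)
    fix r :: real
    have "-1 - r = - (1 + r)" by simp
    then show "1 / (-1 - r) = - (1 / (1 + r))" by (simp only: minus_divide_right)
  qed simp
  have "1 / (1 + x) \<le> (\<Sum>r\<in>R. 1 / (1 + r))"
  proof (intro member_le_sum xR roots(1))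
    show "0 \<le> 1 / (1 + r)" if "r \<in> R - {x}" for r
      using bounds(1)[of r] that by simp
  qed
  then have "1 \<le> (\<Sum>r\<in>R. 1 / (1 + r)) * (1 + x)"
    using bounds[OF xR] by (simp add: field_simps)
  then show "4 \<le> (real N * (real N + 1) - 2) * (1 + x)" by (simp add: s2 s3)
qed

text \<open>Follows from the end point distances because 1 - x^2 >= 1 - |x|. The constant 4 is what
  later produces the ratio 9/8 in \<open>legendre_critical_value_bounds\<close>.\<close>

lemma lgl_node_omega_lower:
  assumes i: "1 \<le> i" "i < N"
  shows "4 \<le> real N * (real N + 1) * (1 - (lgl_node N i)\<^sup>2)"
proof -
  define x where "x = lgl_node N i"
  define c where "c = real N * (real N + 1)"
  have x: "-1 < x" "x < 1" using lgl_node_interior[OF i] by (simp_all add: x_def)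
  have c: "0 \<le> c" by (simp add: c_def)
  have "4 \<le> c * (1 - \<bar>x\<bar>)"
    using lgl_node_end_distance[OF i] x by (cases "0 \<le> x") (auto simp: c_def x_def algebra_simps)
  also have "\<dots> \<le> c * (1 - x\<^sup>2)"
    using x c mult_left_le_one_le[of "\<bar>x\<bar>" "\<bar>x\<bar>"]
    by (intro mult_left_mono) (auto simp: power2_eq_square)
  finally show ?thesis by (simp add: c_def x_def)
qed

subsection \<open>Sonin functions\<close>

lemma omega_pos: "-1 < x \<Longrightarrow> x < 1 \<Longrightarrow> 0 < 1 - (x::real)\<^sup>2"
  using abs_square_less_1[of x] by simp

context
  fixes N :: nat and L :: "real poly" and c :: real
  assumes L_def: "L = legendre_poly N" and c_def: "c = real N * (real N + 1)"
begin

text \<open>With x = cos phi, the function v = (sin phi)^(1/2) L(cos phi) solves v'' + Q v = 0,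
  where Q is \<open>sonin_factor\<close>. The polynomial is sin phi times Q v^2 + v'^2, primes
  denoting derivatives in phi. Thus \<open>sonin1\<close> and \<open>sonin2\<close> are Sonin's
  functions Q v^2 + v'^2 and v^2 + v'^2 / Q.\<close>

definition sonin_numerator :: "real poly" where
  "sonin_numerator = omega * (Polynomial.smult c (L * L) - [:0, 1:] * (L * pderiv L) + omega * (pderiv L * pderiv L))
    + Polynomial.smult (1 / 2) (L * L)"

lemma poly_sonin_numerator:
  "poly sonin_numerator x = (1 - x\<^sup>2) * (c * (poly L x)\<^sup>2 - x * poly L x * poly (pderiv L) x
      + (1 - x\<^sup>2) * (poly (pderiv L) x)\<^sup>2) + (poly L x)\<^sup>2 / 2"
  by (simp add: sonin_numerator_def power2_eq_square algebra_simps)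

text \<open>The left side is (1 - x^2)^(3/2) times the derivative of \<open>sonin1\<close>.
  Eliminating L'' by Legendre's equation also removes L' and leaves an expression with the sign of
  \<open>x\<close>.\<close>

lemma sonin_numerator_deriv:
  "(1 - x\<^sup>2) * poly (pderiv sonin_numerator) x + x * poly sonin_numerator x = x * (poly L x)\<^sup>2 / 2"
proof -
  define y y1 y2 where "y = poly L x" and "y1 = poly (pderiv L) x" and "y2 = poly (pderiv (pderiv L)) x"
  have ode: "(1 - x\<^sup>2) * y2 = 2 * x * y1 - c * y"
    using legendre_ode[of x N] by (simp add: y_def y1_def y2_def L_def c_def)
  have "poly (pderiv sonin_numerator) x = - 2 * x * (c * y\<^sup>2 - x * y * y1 + (1 - x\<^sup>2) * y1\<^sup>2)
    + (1 - x\<^sup>2) * (2 * c * y * y1 - y * y1 - x * y1\<^sup>2 - 2 * x * y1\<^sup>2) + y * y1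
    - x * y * ((1 - x\<^sup>2) * y2) + 2 * (1 - x\<^sup>2) * y1 * ((1 - x\<^sup>2) * y2)"
    unfolding sonin_numerator_def
    by (simp add: pderiv_rules y_def y1_def y2_def power2_eq_square algebra_simps)
  also have "\<dots> = - 2 * x * (c * y\<^sup>2 - x * y * y1 + (1 - x\<^sup>2) * y1\<^sup>2)
    + (1 - x\<^sup>2) * (2 * c * y * y1 - y * y1 - x * y1\<^sup>2 - 2 * x * y1\<^sup>2) + y * y1
    - x * y * (2 * x * y1 - c * y) + 2 * (1 - x\<^sup>2) * y1 * (2 * x * y1 - c * y)"
    unfolding ode ..
  finally show ?thesis
    by (simp add: poly_sonin_numerator flip: y_def y1_def) (simp add: power2_eq_square algebra_simps)
qed

definition sonin1 :: "real \<Rightarrow> real" where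
  "sonin1 x = poly sonin_numerator x / sqrt (1 - x\<^sup>2)"

definition sonin_factor :: "real \<Rightarrow> real" where
  "sonin_factor x = c + 1 / 4 + 1 / (4 * (1 - x\<^sup>2))"

definition sonin2 :: "real \<Rightarrow> real" where
  "sonin2 x = sonin1 x / sonin_factor x"

lemma c_nonneg: "0 \<le> c"
  by (simp add: c_def)

lemma sonin_factor_pos: "-1 < x \<Longrightarrow> x < 1 \<Longrightarrow> 0 < sonin_factor x"
  using omega_pos[of x] c_nonneg by (auto simp: sonin_factor_def intro!: add_nonneg_pos)

lemma DERIV_sonin1:
  assumes "-1 < x" "x < 1"
  shows "(sonin1 has_real_derivative x * (poly L x)\<^sup>2 / (2 * (1 - x\<^sup>2) * sqrt (1 - x\<^sup>2))) (at x)"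
proof -
  define s where "s = sqrt (1 - x\<^sup>2)"
  note pos = omega_pos[OF assms]
  have s: "0 < s" "s * s = 1 - x\<^sup>2" using pos by (simp_all add: s_def)
  have ds: "((\<lambda>x. sqrt (1 - x\<^sup>2)) has_real_derivative - x / s) (at x)"
    using pos by (auto intro!: derivative_eq_intros simp: s_def field_simps)
  have "(sonin1 has_real_derivative
      (poly (pderiv sonin_numerator) x * s - poly sonin_numerator x * (- x / s)) / (s * s)) (at x)"
    using DERIV_divide[OF poly_DERIV ds] s unfolding sonin1_def s_def by auto
  moreover have "(poly (pderiv sonin_numerator) x * s - poly sonin_numerator x * (- x / s)) / (s * s)
      = ((s * s) * poly (pderiv sonin_numerator) x + x * poly sonin_numerator x) / (s * s * s)"
    using s(1) by (simp add: field_simps)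
  moreover have "\<dots> = x * (poly L x)\<^sup>2 / (2 * (1 - x\<^sup>2) * s)"
    unfolding s(2) sonin_numerator_deriv by simp
  ultimately show ?thesis by (simp add: s_def)
qed

text \<open>In the variable phi, differentiating v^2 + v'^2 / Q and using v'' = - Q v leaves only -
  Q' v'^2 / Q^2. The square in the numerator is v'^2 times sqrt(1 - x^2).\<close>

lemma DERIV_sonin2:
  assumes "-1 < x" "x < 1"
  shows "(sonin2 has_real_derivative
    - x * (x * poly L x / 2 - (1 - x\<^sup>2) * poly (pderiv L) x)\<^sup>2
      / (2 * (1 - x\<^sup>2)\<^sup>2 * sqrt (1 - x\<^sup>2) * (sonin_factor x)\<^sup>2)) (at x)"
proof -
  define s w where "s = sqrt (1 - x\<^sup>2)" and "w = 1 - x\<^sup>2"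
  define q y y1 where "q = sonin_factor x" and "y = poly L x" and "y1 = poly (pderiv L) x"
  have w: "0 < w" using omega_pos[OF assms] by (simp add: w_def)
  have s: "0 < s" using w by (simp add: s_def w_def)
  have q: "0 < q" using sonin_factor_pos[OF assms] by (simp add: q_def)
  have dq: "(sonin_factor has_real_derivative x / (2 * w\<^sup>2)) (at x)"
  proof -
    have dw: "((\<lambda>x. 1 - x\<^sup>2) has_real_derivative - 2 * x) (at x)"
      by (auto intro!: derivative_eq_intros)
    have x: "1 - x\<^sup>2 \<noteq> 0" using omega_pos[OF assms] by simp
    have 1: "1 / (4 * w) = inverse w / 4" for w :: real
      by (simp add: field_simps)
    have 2: "0 + - (inverse w * (- 2 * x) * inverse w) / 4 = x / (2 * w\<^sup>2)" if "w \<noteq> 0" for w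
      using that by (simp add: field_simps power2_eq_square)
    show ?thesis
      unfolding sonin_factor_def w_def 1 2[OF x, symmetric]
      by (rule DERIV_add[OF DERIV_const DERIV_cdivide[OF DERIV_inverse'[OF dw x]]])
  qed
  have wq: "w * y\<^sup>2 * q = w * (c * y\<^sup>2 + y\<^sup>2 / 4) + y\<^sup>2 / 4"
    using w by (simp add: q_def sonin_factor_def field_simps flip: w_def)
  \<comment> \<open>The splitting into Q v^2 and v'^2, each times sqrt(1 - x^2). The first part
    cancels in the quotient rule, so that only a square remains.\<close>
  have H: "poly sonin_numerator x = w * y\<^sup>2 * q + (x * y / 2 - w * y1)\<^sup>2"
    unfolding poly_sonin_numerator wq y_def[symmetric] y1_def[symmetric]
    by (simp add: w_def power2_eq_square field_simps)
  have "(sonin2 has_real_derivative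
     (x * y\<^sup>2 / (2 * w * s) * q - poly sonin_numerator x / s * (x / (2 * w\<^sup>2))) / (q * q)) (at x)"
    using DERIV_divide[OF DERIV_sonin1[OF assms] dq] q
    unfolding sonin2_def sonin1_def s_def w_def q_def y_def by auto
  moreover have "(x * y\<^sup>2 / (2 * w * s) * q - poly sonin_numerator x / s * (x / (2 * w\<^sup>2))) / (q * q)
     = - x * (x * y / 2 - w * y1)\<^sup>2 / (2 * w\<^sup>2 * s * q\<^sup>2)"
  proof -
    have "x * y\<^sup>2 / (2 * w * s) * q = x * (w * y\<^sup>2 * q) / (2 * w\<^sup>2 * s)"
      using w s by (simp add: field_simps power2_eq_square)
    moreover have "poly sonin_numerator x / s * (x / (2 * w\<^sup>2)) = x * poly sonin_numerator x / (2 * w\<^sup>2 * s)"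
      by (simp add: mult.commute mult.left_commute)
    ultimately have "x * y\<^sup>2 / (2 * w * s) * q - poly sonin_numerator x / s * (x / (2 * w\<^sup>2))
       = (x * (w * y\<^sup>2 * q) - x * poly sonin_numerator x) / (2 * w\<^sup>2 * s)"
      by (simp add: diff_divide_distrib)
    also have "x * (w * y\<^sup>2 * q) - x * poly sonin_numerator x = - x * (x * y / 2 - w * y1)\<^sup>2"
      unfolding H by (simp add: algebra_simps)
    finally show ?thesis by (simp add: power2_eq_square)
  qed
  ultimately show ?thesis by (simp add: s_def w_def q_def y_def y1_def)
qed

lemma sonin1_ge:
  assumes "-1 < x" "x < 1"
  shows "sonin1 0 \<le> sonin1 x"
proof (cases "0 \<le> x")
  case True
  show ?thesis
  proof (rule DERIV_nonneg_imp_nondecreasing[where f = sonin1, OF True])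
    fix t assume t: "0 \<le> t" "t \<le> x"
    then have b: "-1 < t" "t < 1" using assms by auto
    have den: "0 < 2 * (1 - t\<^sup>2) * sqrt (1 - t\<^sup>2)"
      using omega_pos[OF b] by simp
    show "\<exists>d. (sonin1 has_real_derivative d) (at t) \<and> 0 \<le> d"
      by (rule exI, rule conjI, rule DERIV_sonin1[OF b], rule divide_nonneg_pos[OF _ den])
         (use t in \<open>simp add: mult_nonpos_nonneg\<close>)
  qed
next
  case False
  then have "x \<le> 0" by simp
  then show ?thesis
  proof (rule DERIV_nonpos_imp_nonincreasing[where f = sonin1])
    fix t assume t: "x \<le> t" "t \<le> 0"
    then have b: "-1 < t" "t < 1" using assms by auto
    have den: "0 < 2 * (1 - t\<^sup>2) * sqrt (1 - t\<^sup>2)"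
      using omega_pos[OF b] by simp
    show "\<exists>d. (sonin1 has_real_derivative d) (at t) \<and> d \<le> 0"
      by (rule exI, rule conjI, rule DERIV_sonin1[OF b], rule divide_nonpos_pos[OF _ den])
         (use t in \<open>simp add: mult_nonpos_nonneg\<close>)
  qed
qed

lemma sonin2_le:
  assumes "-1 < x" "x < 1"
  shows "sonin2 x \<le> sonin2 0"
proof (cases "0 \<le> x")
  case True
  show ?thesis
  proof (rule DERIV_nonpos_imp_nonincreasing[where f = sonin2, OF True])
    fix t assume t: "0 \<le> t" "t \<le> x"
    then have b: "-1 < t" "t < 1" using assms by auto
    have den: "0 < 2 * (1 - t\<^sup>2)\<^sup>2 * sqrt (1 - t\<^sup>2) * (sonin_factor t)\<^sup>2"
      using omega_pos[OF b] sonin_factor_pos[OF b] by simp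
    show "\<exists>d. (sonin2 has_real_derivative d) (at t) \<and> d \<le> 0"
      by (rule exI, rule conjI, rule DERIV_sonin2[OF b], rule divide_nonpos_pos[OF _ den])
         (use t in \<open>simp add: mult_nonpos_nonneg\<close>)
  qed
next
  case False
  then have "x \<le> 0" by simp
  then show ?thesis
  proof (rule DERIV_nonneg_imp_nondecreasing[where f = sonin2])
    fix t assume t: "x \<le> t" "t \<le> 0"
    then have b: "-1 < t" "t < 1" using assms by auto
    have den: "0 < 2 * (1 - t\<^sup>2)\<^sup>2 * sqrt (1 - t\<^sup>2) * (sonin_factor t)\<^sup>2"
      using omega_pos[OF b] sonin_factor_pos[OF b] by simp
    show "\<exists>d. (sonin2 has_real_derivative d) (at t) \<and> 0 \<le> d"
      by (rule exI, rule conjI, rule DERIV_sonin2[OF b], rule divide_nonneg_pos[OF _ den])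
         (use t in \<open>simp add: mult_nonpos_nonneg\<close>)
  qed
qed

text \<open>Put \<open>w = 1 - x^2\<close> and \<open>f = L^2 sqrt w\<close>. Where L' vanishes,
  \<open>sonin1\<close> equals \<open>(c + 1 / (2 w)) f\<close>, which is at most
  \<open>9 / 8 * c * f\<close>, and \<open>sonin2\<close> is at least \<open>f\<close>. The first is
  smallest at 0 and the second is largest there, so \<open>c * f\<close> is trapped between 8/9 of
  \<open>sonin1 0\<close> and \<open>sonin1 0\<close>.\<close>

lemma legendre_critical_value_bounds:
  assumes x: "-1 < x" "x < 1" and crit: "poly (pderiv L) x = 0" and "4 \<le> c * (1 - x\<^sup>2)"
  shows "8 * sonin1 0 \<le> 9 * (c * ((poly L x)\<^sup>2 * sqrt (1 - x\<^sup>2)))"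
    and "c * ((poly L x)\<^sup>2 * sqrt (1 - x\<^sup>2)) \<le> sonin1 0"
proof -
  define s w y where "s = sqrt (1 - x\<^sup>2)" and "w = 1 - x\<^sup>2" and "y = poly L x"
  define f where "f = y\<^sup>2 * s"
  have w: "0 < w" "w \<le> 1" using omega_pos[OF x] by (simp_all add: w_def)
  have s: "0 < s" "s * s = w" using w by (simp_all add: s_def w_def)
  have cw: "4 \<le> c * w" using assms(4) by (simp add: w_def)
  then have "0 < c * w" by simp
  then have c: "0 < c" using w(1) by (simp add: zero_less_mult_iff)
  have f: "0 \<le> f" using s by (simp add: f_def)
  have "poly sonin_numerator x = (c * w + 1 / 2) * y\<^sup>2"
    by (simp add: poly_sonin_numerator crit w_def y_def algebra_simps)
  then have "sonin1 x = (c * w + 1 / 2) * y\<^sup>2 / s"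
    by (simp add: sonin1_def s_def)
  also have "\<dots> = (c * w + 1 / 2) * f / w"
    unfolding f_def s(2)[symmetric] using s(1) by (simp add: field_simps)
  also have "\<dots> = (c + 1 / (2 * w)) * f"
    using w by (simp add: field_simps)
  finally have S1: "sonin1 x = (c + 1 / (2 * w)) * f" .
  have "1 / (2 * w) \<le> c / 8"
    using cw w by (simp add: field_simps)
  then have "sonin1 x \<le> (c + c / 8) * f"
    unfolding S1 using f by (intro mult_right_mono add_left_mono)
  then show "8 * sonin1 0 \<le> 9 * (c * ((poly L x)\<^sup>2 * sqrt (1 - x\<^sup>2)))"
    using sonin1_ge[OF x] by (simp add: f_def y_def s_def algebra_simps)
  have fac: "sonin_factor x = c + 1 / 4 + 1 / (4 * w)" by (simp add: sonin_factor_def w_def)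
  have "sonin_factor x \<le> c + 1 / (2 * w)"
    unfolding fac using w by (simp add: field_simps)
  then have "sonin_factor x * f \<le> sonin1 x"
    unfolding S1 using f by (intro mult_right_mono)
  then have "f \<le> sonin2 x"
    using sonin_factor_pos[OF x] by (simp add: sonin2_def field_simps)
  also have "\<dots> \<le> sonin2 0" by (rule sonin2_le[OF x])
  \<comment> \<open>\<open>sonin_factor\<close> equals \<open>c + 1 / 2\<close> at 0.\<close>
  finally have "f \<le> sonin1 0 / (1 / 2 + c)"
    by (simp add: sonin2_def sonin_factor_def)
  then have "c * f + f / 2 \<le> sonin1 0"
    using c by (simp add: field_simps)
  then show "c * ((poly L x)\<^sup>2 * sqrt (1 - x\<^sup>2)) \<le> sonin1 0"
    using f by (simp add: f_def y_def s_def)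
qed

end

text \<open>By \<open>lgl_weight_eq\<close> the quotient of weight and square root is
  \<open>2 / (c * f i)\<close>, and \<open>legendre_critical_value_bounds\<close> confines
  \<open>c * f i\<close> up to the ratio 9/8. The scaling \<open>t\<close> is half the value of
  \<open>sonin1\<close> at 0.\<close>

lemma lgl_weight_ratio_bounds:
  assumes N: "2 \<le> N"
  shows "\<exists>t>0. \<forall>i. 1 \<le> i \<and> i < N \<longrightarrow>
    1 \<le> t * (lgl_weight N i / sqrt (1 - (lgl_node N i)\<^sup>2)) \<and>
    t * (lgl_weight N i / sqrt (1 - (lgl_node N i)\<^sup>2)) \<le> 9 / 8"
proof -
  define L where "L = legendre_poly N"
  define c where "c = real N * (real N + 1)"
  define e where "e = sonin1 L c 0"
  define f where "f i = (poly L (lgl_node N i))\<^sup>2 * sqrt (1 - (lgl_node N i)\<^sup>2)" for i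
  have c: "0 < c" using N by (simp add: c_def)
  have b: "8 * e \<le> 9 * (c * f i)" "c * f i \<le> e" if i: "1 \<le> i" "i < N" for i
  proof -
    have "poly (pderiv L) (lgl_node N i) = 0" "4 \<le> c * (1 - (lgl_node N i)\<^sup>2)"
      using lgl_node_interior(3)[OF i] lgl_node_omega_lower[OF i] by (simp_all only: L_def c_def)
    note * = legendre_critical_value_bounds[OF L_def c_def lgl_node_interior(1,2)[OF i] this]
    show "8 * e \<le> 9 * (c * f i)" "c * f i \<le> e"
      unfolding e_def f_def by (fact *)+
  qed
  have w: "c * lgl_weight N i * (poly L (lgl_node N i))\<^sup>2 = 2" if "i < N" for i
    using lgl_weight_eq[of N i] N that by (simp add: L_def c_def)
  have f_pos: "0 < f i" if i: "1 \<le> i" "i < N" for i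
    using w[of i] i omega_pos[of "lgl_node N i"] lgl_node_interior[OF i]
    by (auto simp: f_def intro!: mult_pos_pos)
  have eq: "lgl_weight N i / sqrt (1 - (lgl_node N i)\<^sup>2) = 2 / (c * f i)" if i: "1 \<le> i" "i < N" for i
  proof -
    have "poly L (lgl_node N i) \<noteq> 0" using w[of i] i by auto
    then have "lgl_weight N i = 2 / (c * (poly L (lgl_node N i))\<^sup>2)"
      using w[of i] i c by (subst nonzero_eq_divide_eq) (simp_all add: algebra_simps)
    then show ?thesis by (simp add: f_def)
  qed
  have "0 < c * f 1" using f_pos[of 1] c N by simp
  then have e: "0 < e" using b(2)[of 1] N by simp
  show ?thesis
  proof (intro exI[of _ "e / 2"] conjI allI impI)
    fix i assume i: "1 \<le> i \<and> i < N"
    then have "0 < c * f i" using f_pos c by simp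
    then have g: "1 \<le> e / (c * f i)" "e / (c * f i) \<le> 9 / 8"
      using b[of i] i by (auto simp: pos_divide_le_eq)
    have "e / 2 * (lgl_weight N i / sqrt (1 - (lgl_node N i)\<^sup>2)) = e / (c * f i)"
      using eq[of i] i by (simp only: eq) simp
    with g show "1 \<le> e / 2 * (lgl_weight N i / sqrt (1 - (lgl_node N i)\<^sup>2))"
      "e / 2 * (lgl_weight N i / sqrt (1 - (lgl_node N i)\<^sup>2)) \<le> 9 / 8"
      by (simp_all only:)
  qed (use e in simp)
qed

subsection \<open>Coercivity of the collocation second derivative\<close>

text \<open>
  The function \<open>\<phi>\<close> is the claimed form evaluated at the vector \<open>e\<^sup>-\<^sup>t\<^sup>X v\<close>. Its derivative is minus the sum
  of the two given forms, so it decreases, and it tends to \<open>0\<close>.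
\<close>

lemma interpolate_weighted_forms:
  fixes s :: "'a \<Rightarrow> 'a \<Rightarrow> real" and X :: "'a \<Rightarrow> real"
  assumes X: "\<And>i. i \<in> I \<Longrightarrow> 0 < X i"
    and form0: "\<And>v. 0 \<le> (\<Sum>i\<in>I. \<Sum>j\<in>I. s i j * v i * v j)"
    and form2: "\<And>v. 0 \<le> (\<Sum>i\<in>I. \<Sum>j\<in>I. (X i)\<^sup>2 * s i j * v i * v j)"
  shows "0 \<le> (\<Sum>i\<in>I. \<Sum>j\<in>I. X i * s i j * v i * v j)"
proof -
  define \<phi> where
    "\<phi> t = (\<Sum>i\<in>I. \<Sum>j\<in>I. X i * s i j * v i * v j * exp (- (X i + X j) * t))" for t
  define \<psi> where
    "\<psi> t = (\<Sum>i\<in>I. \<Sum>j\<in>I. X i * s i j * v i * v j * (exp (- (X i + X j) * t) * (- (X i + X j))))" for t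
  have deriv: "(\<phi> has_real_derivative \<psi> t) (at t)" for t
    unfolding \<phi>_def \<psi>_def
    by (auto intro!: derivative_eq_intros sum.cong)
  have \<psi>_nonpos: "\<psi> t \<le> 0" for t
  proof -
    define u where "u i = v i * exp (- X i * t)" for i
    have "X i * s i j * v i * v j * (exp (- (X i + X j) * t) * (- (X i + X j)))
       = - ((X i)\<^sup>2 * s i j * u i * u j + s i j * (X i * u i) * (X j * u j))" for i j
    proof -
      have "exp (- (X i + X j) * t) = exp (- X i * t) * exp (- X j * t)"
        by (simp add: algebra_simps flip: exp_add)
      then show ?thesis by (simp add: u_def power2_eq_square algebra_simps)
    qed
    then have "\<psi> t = - ((\<Sum>i\<in>I. \<Sum>j\<in>I. (X i)\<^sup>2 * s i j * u i * u j)
        + (\<Sum>i\<in>I. \<Sum>j\<in>I. s i j * (X i * u i) * (X j * u j)))"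
      by (simp only: \<psi>_def sum_negf sum.distrib)
    then show ?thesis using form0[of "\<lambda>i. X i * u i"] form2[of u] by simp
  qed
  have "((\<lambda>t. exp (- (X i + X j) * t)) \<longlongrightarrow> 0) at_top" if "i \<in> I" "j \<in> I" for i j
  proof (rule filterlim_compose[OF exp_at_bot])
    have "0 < X i + X j" using X that by (simp add: add_pos_pos)
    then show "filterlim (\<lambda>t. - (X i + X j) * t) at_bot at_top"
      by (intro filterlim_tendsto_neg_mult_at_bot[OF tendsto_const _ filterlim_ident]) simp
  qed
  then have "(\<phi> \<longlongrightarrow> (\<Sum>i\<in>I. \<Sum>j\<in>I. X i * s i j * v i * v j * 0)) at_top"
    unfolding \<phi>_def by (intro tendsto_sum tendsto_mult tendsto_const) auto
  then have lim: "(\<phi> \<longlongrightarrow> 0) at_top" by simp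
  have "\<phi> t \<le> \<phi> 0" if "0 \<le> t" for t
    using DERIV_nonpos_imp_nonincreasing[of 0 t \<phi>] deriv \<psi>_nonpos that by blast
  then have "0 \<le> \<phi> 0"
    by (intro tendsto_upperbound[OF lim]) (auto intro: eventually_at_top_linorderI[of 0])
  then show ?thesis by (simp add: \<phi>_def)
qed

context
  fixes N :: nat
  assumes N: "2 \<le> N"
begin

lemma N_ge_1: "1 \<le> N"
  using N by simp

definition interpolant :: "(nat \<Rightarrow> real) \<Rightarrow> real poly" where
  "interpolant v = (\<Sum>j\<in>{1..<N}. Polynomial.smult (v j) (lagrange_basis N j))"

lemma degree_interpolant: "degree (interpolant v) \<le> N"
  unfolding interpolant_def
  by (intro degree_sum_le) (auto intro!: order.trans[OF degree_smult_le] lagrange_basis_spec(1)[OF N_ge_1])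

lemma poly_interpolant:
  assumes "i \<le> N"
  shows "poly (interpolant v) (lgl_node N i) = (if i \<in> {1..<N} then v i else 0)"
proof -
  have "poly (interpolant v) (lgl_node N i) = (\<Sum>j\<in>{1..<N}. if i = j then v j else 0)"
    unfolding interpolant_def poly_sum
    by (rule sum.cong) (use assms in \<open>auto simp: lagrange_basis_spec(2)[OF N_ge_1]\<close>)
  then show ?thesis by simp
qed

lemma interpolant_ends: "poly (interpolant v) 1 = 0" "poly (interpolant v) (-1) = 0"
  using poly_interpolant[of N v] poly_interpolant[of 0 v]
  by (simp_all add: lgl_node_0[OF N_ge_1] lgl_node_N[OF N_ge_1])

lemma sum_nodes_split:
  fixes f :: "nat \<Rightarrow> real"
  shows "(\<Sum>i\<le>N. f i) = f 0 + f N + (\<Sum>i\<in>{1..<N}. f i)"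
proof -
  have "{..N} = insert 0 (insert N {1..<N})" using N by auto
  then show ?thesis using N by simp
qed

lemma lgl_weight_nonneg:
  assumes "i \<le> N"
  shows "0 \<le> lgl_weight N i"
proof (rule ccontr)
  assume "\<not> 0 \<le> lgl_weight N i"
  then have "real N * (real N + 1) * lgl_weight N i * (poly (legendre_poly N) (lgl_node N i))\<^sup>2 \<le> 0"
    by (intro mult_nonpos_nonneg mult_nonneg_nonpos) auto
  then show False using lgl_weight_eq[OF N_ge_1 assms] by simp
qed

lemma lgl_weight_ends:
  "lgl_weight N 0 = 2 / (real N * (real N + 1))" "lgl_weight N N = 2 / (real N * (real N + 1))"
proof -
  have c: "real N * (real N + 1) \<noteq> 0" using N by simp
  have "real N * (real N + 1) * lgl_weight N 0 = 2" "real N * (real N + 1) * lgl_weight N N = 2"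
    using lgl_weight_eq[OF N_ge_1, of 0] lgl_weight_eq[OF N_ge_1, of N]
    by (simp_all add: lgl_node_0[OF N_ge_1] lgl_node_N[OF N_ge_1] flip: power_mult)
  then show "lgl_weight N 0 = 2 / (real N * (real N + 1))"
    "lgl_weight N N = 2 / (real N * (real N + 1))"
    using c by (simp_all only: nonzero_eq_divide_eq mult.commute not_False_eq_True)
qed

text \<open>The quadrature rule is exact for \<open>u u''\<close>, of degree at most
  \<open>2 N - 2\<close>, and \<open>u\<close> vanishes at the end nodes, so the right side is the
  integral \<open>E\<close> of \<open>u'^2\<close>. The bound \<open>u^2 <= 2 E\<close> at the nodes
  and the total weight 2 give the constant 1/4.\<close>

lemma coercive_unweighted:
  "1 / 4 * (\<Sum>i\<in>{1..<N}. lgl_weight N i * (v i)\<^sup>2)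
    \<le> (\<Sum>i\<in>{1..<N}. lgl_weight N i * (v i * - poly (pderiv (pderiv (interpolant v))) (lgl_node N i)))"
proof -
  define u where "u = interpolant v"
  define E where "E = integ ((pderiv u)\<^sup>2)"
  have u_node: "poly u (lgl_node N i) = v i" if "i \<in> {1..<N}" for i
    using poly_interpolant[of i v] that by (simp add: u_def)
  have ends: "poly u 1 = 0" "poly u (-1) = 0" by (simp_all add: u_def interpolant_ends)
  have "degree (- (u * pderiv (pderiv u))) \<le> degree u + degree (pderiv (pderiv u))"
    by (simp add: degree_mult_le)
  also have "\<dots> \<le> 2 * N - 1"
    using degree_interpolant[of v] N by (simp add: degree_pderiv u_def)
  finally have "integ (- (u * pderiv (pderiv u)))
      = (\<Sum>i\<le>N. lgl_weight N i * poly (- (u * pderiv (pderiv u))) (lgl_node N i))"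
    by (rule lgl_quadrature[OF N_ge_1])
  also have "\<dots> = (\<Sum>i\<in>{1..<N}. lgl_weight N i * (v i * - poly (pderiv (pderiv u)) (lgl_node N i)))"
    unfolding sum_nodes_split
    by (simp add: lgl_node_0[OF N_ge_1] lgl_node_N[OF N_ge_1] ends u_node)
  finally have form: "(\<Sum>i\<in>{1..<N}. lgl_weight N i * (v i * - poly (pderiv (pderiv u)) (lgl_node N i))) = E"
    by (simp add: integ_minus integ_by_parts ends E_def power2_eq_square)
  have "integ 1 = 2"
    by (subst integ_eqI[of "[:0, 1:]"]) (simp_all add: pderiv_pCons)
  then have weights: "(\<Sum>i\<le>N. lgl_weight N i) = 2"
    using lgl_quadrature[OF N_ge_1, of 1] by simp
  have "(\<Sum>i\<in>{1..<N}. lgl_weight N i * (v i)\<^sup>2) \<le> (\<Sum>i\<in>{1..<N}. lgl_weight N i * (2 * E))"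
  proof (intro sum_mono mult_left_mono)
    fix i assume i: "i \<in> {1..<N}"
    show "(v i)\<^sup>2 \<le> 2 * E"
      using poly_sq_le_integ_pderiv_sq[OF ends(2), of "lgl_node N i"] lgl_node_interior[of i N] i
      by (simp add: u_node E_def)
    show "0 \<le> lgl_weight N i" using i by (simp add: lgl_weight_nonneg)
  qed
  also have "\<dots> = (\<Sum>i\<in>{1..<N}. lgl_weight N i) * (2 * E)"
    by (simp add: sum_distrib_right)
  also have "\<dots> \<le> 2 * (2 * E)"
  proof (rule mult_right_mono)
    show "(\<Sum>i\<in>{1..<N}. lgl_weight N i) \<le> 2"
      using weights sum_nodes_split[of "lgl_weight N"] lgl_weight_nonneg[of 0] lgl_weight_nonneg[of N]
      by simp
    show "0 \<le> 2 * E" unfolding E_def by (simp add: integ_nonneg)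
  qed
  finally show ?thesis using form by (simp add: u_def)
qed

text \<open>
  The end point terms left over by the quadrature rule are absorbed by completing the square with
  the polynomial \<open>r\<close>, which represents the linear functional
  \<open>p \<mapsto> 2 w\<^sub>0 (V(1) p(1) - V(-1) p(-1))\<close> in the inner product with weight \<open>1 - x\<^sup>2\<close>.
\<close>

lemma end_term_bound:
  assumes V: "degree V \<le> N - 2"
  defines "w \<equiv> 2 / (real N * (real N + 1))"
  shows "4 * w * (poly V 1 * poly (pderiv V) 1 - poly V (-1) * poly (pderiv V) (-1))
    \<le> integ (omega * (pderiv V * pderiv V)) + (1 - 2 * w) * ((poly V 1)\<^sup>2 + (poly V (-1))\<^sup>2)"
proof -
  define \<epsilon> :: real where "\<epsilon> = (-1) ^ N"
  define a b where "a = poly V 1" and "b = poly V (-1)"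
  \<comment> \<open>By \<open>integ_weight_legendre_deriv2\<close> the two second derivatives in
    \<open>r\<close> represent \<open>2 p(1) - 2 \<epsilon> p(-1)\<close> and
    \<open>2 p(1) + 2 \<epsilon> p(-1)\<close>; \<open>A\<close> and \<open>B\<close> combine these
    to the wanted functional.\<close>
  define A B where "A = w * (a + \<epsilon> * b) / 2" and "B = w * (a - \<epsilon> * b) / 2"
  define r where "r = Polynomial.smult A (pderiv (pderiv (legendre_poly (N - 1))))
    + Polynomial.smult B (pderiv (pderiv (legendre_poly (N - 2))))"
  define n where "n = real N"
  \<comment> \<open>The values at 1 of L_(N-1)'' and L_(N-2)''.\<close>
  define \<mu> \<nu> where "\<mu> = (n - 2) * (n - 1) * n * (n + 1) / 8" and "\<nu> = (n - 3) * (n - 2) * (n - 1) * n / 8"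
  have n: "2 \<le> n" "real (N - 1) = n - 1" "real (N - 2) = n - 2"
    using N by (simp_all add: n_def)
  have \<epsilon>: "\<epsilon> * \<epsilon> = 1" by (simp add: \<epsilon>_def flip: power_mult_distrib)
  have signs: "(-1) ^ (N - 1) = - \<epsilon>" "(-1) ^ (N - 2) = \<epsilon>"
  proof -
    obtain k where k: "N = Suc (Suc k)" using N by (metis add_2_eq_Suc le_Suc_ex)
    show "(-1) ^ (N - 1) = - \<epsilon>" "(-1) ^ (N - 2) = \<epsilon>" by (simp_all add: \<epsilon>_def k)
  qed
  have functional: "integ (omega * p * r) = 2 * w * (a * poly p 1 - b * poly p (-1))"
    if p: "degree p < N - 2 \<or> p = 0" for p
  proof -
    have "omega * p * r = Polynomial.smult A (omega * p * pderiv (pderiv (legendre_poly (N - 1))))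
      + Polynomial.smult B (omega * p * pderiv (pderiv (legendre_poly (N - 2))))"
      by (simp only: r_def distrib_left mult_smult_right)
    moreover have "degree p < N - 1 \<or> p = 0" using p by auto
    ultimately have "integ (omega * p * r)
      = A * (2 * poly p 1 - 2 * \<epsilon> * poly p (-1)) + B * (2 * poly p 1 + 2 * \<epsilon> * poly p (-1))"
      using integ_weight_legendre_deriv2[of p "N - 1"] integ_weight_legendre_deriv2[of p "N - 2"] p
      by (simp only: integ_add integ_smult signs) simp
    also have "\<dots> = 2 * w * (a * poly p 1 - (\<epsilon> * \<epsilon>) * b * poly p (-1))"
      by (simp add: A_def B_def field_simps)
    finally show ?thesis by (simp add: \<epsilon>)
  qed
  have r1: "poly r 1 = A * \<mu> + B * \<nu>"
    by (simp add: r_def legendre_deriv2_1 n \<mu>_def \<nu>_def del: One_nat_def)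
  have r2: "poly r (-1) = - \<epsilon> * (A * \<mu> - B * \<nu>)"
  proof -
    have "poly (pderiv (pderiv (legendre_poly (N - 1)))) (-1) = - \<epsilon> * \<mu>"
      "poly (pderiv (pderiv (legendre_poly (N - 2)))) (-1) = \<epsilon> * \<nu>"
      unfolding legendre_deriv2_minus1 n signs \<mu>_def \<nu>_def by simp_all
    then show ?thesis by (simp add: r_def algebra_simps del: One_nat_def)
  qed
  have deg_r: "degree r < N - 2 \<or> r = 0"
  \<comment> \<open>For \<open>N = 2\<close> the strict bound on the degree is impossible, but then
    both second derivatives vanish and \<open>r = 0\<close>.\<close>
  proof (cases "N = 2")
    case True
    then have "pderiv (pderiv (legendre_poly (N - 1))) = 0" "pderiv (pderiv (legendre_poly (N - 2))) = 0"
      by (simp_all add: pderiv_eq_0_iff)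
    then show ?thesis by (simp add: r_def)
  next
    case False
    have "degree r \<le> N - 3"
      unfolding r_def
      by (intro degree_add_le order.trans[OF degree_smult_le]) (simp_all add: degree_pderiv)
    then show ?thesis using N False by auto
  qed
  have "pderiv V = 0 \<or> degree (pderiv V) < N - 2"
    using V by (auto simp: pderiv_eq_0_iff degree_pderiv)
  then have cross: "integ (omega * pderiv V * r)
      = 2 * w * (a * poly (pderiv V) 1 - b * poly (pderiv V) (-1))"
    using functional by blast
  have w: "0 < w" using n by (simp add: w_def n_def[symmetric])
  have \<mu>: "0 \<le> \<mu>" "\<nu> \<le> \<mu>"
  proof -
    show "0 \<le> \<mu>" unfolding \<mu>_def using n(1) by simp
    have "\<mu> - \<nu> = (n - 2) * (n - 1) * n / 2" by (simp add: \<mu>_def \<nu>_def field_simps)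
    moreover have "0 \<le> (n - 2) * (n - 1) * n / 2" using n(1) by simp
    ultimately show "\<nu> \<le> \<mu>" by linarith
  qed
  \<comment> \<open>The degree of \<open>r\<close> is small enough to apply the functional to
    \<open>r\<close> itself, which expresses its squared norm by its end point values.\<close>
  have "integ (omega * r * r) = 2 * w * (a * (A * \<mu> + B * \<nu>) + \<epsilon> * b * (A * \<mu> - B * \<nu>))"
    unfolding functional[OF deg_r] r1 r2 by (simp add: algebra_simps)
  also have "\<dots> = 4 * A\<^sup>2 * \<mu> + 4 * B\<^sup>2 * \<nu>"
    by (simp add: A_def B_def power2_eq_square field_simps)
  also have "\<dots> \<le> 4 * A\<^sup>2 * \<mu> + 4 * B\<^sup>2 * \<mu>"
    using \<mu> by (intro add_left_mono mult_left_mono) auto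
  also have "\<dots> = w\<^sup>2 * \<mu> * (2 * a\<^sup>2 + 2 * (\<epsilon> * \<epsilon>) * b\<^sup>2)"
    by (simp add: A_def B_def power2_eq_square field_simps)
  also have "\<dots> = (2 * w\<^sup>2 * \<mu>) * (a\<^sup>2 + b\<^sup>2)"
    by (simp add: \<epsilon> algebra_simps)
  also have "\<dots> \<le> (1 - 2 * w) * (a\<^sup>2 + b\<^sup>2)"
  proof (rule mult_right_mono)
    \<comment> \<open>After cancelling, the claim amounts to
      \<open>(n - 2) * (n - 1) <= n * (n + 1) - 4\<close>, which holds for
      \<open>n >= 2\<close>.\<close>
    have "2 * w\<^sup>2 * \<mu> = (n - 2) * (n - 1) / (n * (n + 1))"
    proof -
      have "2 * (2 / m)\<^sup>2 * (k * m / 8) = k / m" if "m \<noteq> 0" for k m :: real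
        using that by (simp add: power2_eq_square)
      from this[of "n * (n + 1)" "(n - 2) * (n - 1)"] show ?thesis
        using n(1) by (simp only: w_def \<mu>_def n_def[symmetric] mult.assoc) simp
    qed
    also have "\<dots> \<le> (n * (n + 1) - 4) / (n * (n + 1))"
      using n(1) by (intro divide_right_mono) (auto simp: algebra_simps)
    also have "\<dots> = 1 - 2 * w"
      using n(1) by (simp add: w_def n_def[symmetric] diff_divide_distrib)
    finally show "2 * w\<^sup>2 * \<mu> \<le> 1 - 2 * w" .
  qed simp
  finally have rr: "integ (omega * r * r) \<le> (1 - 2 * w) * (a\<^sup>2 + b\<^sup>2)" .
  have "0 \<le> integ (omega * ((pderiv V - r) * (pderiv V - r)))"
  proof (rule integ_nonneg)
    fix x :: real assume "-1 \<le> x" "x \<le> 1"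
    then have "x\<^sup>2 \<le> 1" by (simp add: abs_square_le_1)
    then have "0 \<le> (1 - x\<^sup>2) * (poly (pderiv V - r) x)\<^sup>2" by simp
    also have "\<dots> = poly (omega * ((pderiv V - r) * (pderiv V - r))) x"
      unfolding poly_mult by (simp add: power2_eq_square)
    finally show "0 \<le> poly (omega * ((pderiv V - r) * (pderiv V - r))) x" .
  qed
  also have "omega * ((pderiv V - r) * (pderiv V - r))
      = omega * (pderiv V * pderiv V) - Polynomial.smult 2 (omega * pderiv V * r) + omega * r * r"
  proof -
    have "W * ((p - q) * (p - q)) = W * (p * p) - Polynomial.smult 2 (W * p * q) + W * q * q"
      for W p q :: "real poly"
      by (simp add: algebra_simps poly_eq_poly_eq_iff[symmetric] fun_eq_iff)
    then show ?thesis .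
  qed
  finally have "2 * integ (omega * pderiv V * r)
      \<le> integ (omega * (pderiv V * pderiv V)) + integ (omega * r * r)"
    by (simp only: integ_add integ_diff integ_smult)
  then show ?thesis
    using rr unfolding cross a_def b_def by simp
qed

text \<open>With \<open>u = (1 - x^2) V\<close> the weighted form is the interior part of the
  quadrature sum for \<open>- V u''\<close>. The end nodes contribute as well, because
  \<open>V\<close> need not vanish there; \<open>end_term_bound\<close> absorbs these terms and
  leaves the integral of \<open>V^2\<close> as a lower bound.\<close>

lemma coercive_singular_weight:
  "1 / 4 * (\<Sum>i\<in>{1..<N}. lgl_weight N i / (1 - (lgl_node N i)\<^sup>2) * (v i)\<^sup>2)
    \<le> (\<Sum>i\<in>{1..<N}. lgl_weight N i / (1 - (lgl_node N i)\<^sup>2) *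
          (v i * - poly (pderiv (pderiv (interpolant v))) (lgl_node N i)))"
proof -
  define u where "u = interpolant v"
  define w where "w = 2 / (real N * (real N + 1))"
  obtain p where p: "u = [:-1, 1:] * p"
    using interpolant_ends(1)[of v] by (auto simp: u_def poly_eq_0_iff_dvd elim: dvdE)
  have "poly p (-1) = 0" using interpolant_ends(2)[of v] p by (simp add: u_def)
  then obtain q where q: "p = [:1, 1:] * q"
    using poly_eq_0_iff_dvd[of p "-1"] by (auto elim: dvdE)
  define V where "V = - q"
  have "[:-1, 1:] * ([:1, 1:] * q) = omega * V"
    unfolding V_def by simp
  then have uV: "u = omega * V" using p q by simp
  have deg: "degree V \<le> N - 2"
  proof (cases "V = 0")
    case False
    then have "degree u = degree omega + degree V"
      unfolding uV by (intro degree_mult_eq) simp_all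
    then show ?thesis using degree_interpolant[of v] by (simp add: u_def)
  qed simp
  have u2: "poly (pderiv (pderiv u)) 1 = - 4 * poly (pderiv V) 1 - 2 * poly V 1"
    "poly (pderiv (pderiv u)) (-1) = 4 * poly (pderiv V) (-1) - 2 * poly V (-1)"
    by (simp_all add: uV pderiv_rules)
  have pos: "0 < 1 - (lgl_node N i)\<^sup>2" if "i \<in> {1..<N}" for i
    using omega_pos[of "lgl_node N i"] lgl_node_interior[of i N] that by simp
  have v: "v i = (1 - (lgl_node N i)\<^sup>2) * poly V (lgl_node N i)" if "i \<in> {1..<N}" for i
    using poly_interpolant[of i v] that uV by (simp add: u_def[symmetric] power2_eq_square algebra_simps)
  have quotient: "poly V (lgl_node N i) = v i / (1 - (lgl_node N i)\<^sup>2)" if "i \<in> {1..<N}" for i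
    using v[OF that] pos[OF that] by simp
  have dV: "degree (pderiv (pderiv u)) \<le> N - 2"
    using degree_interpolant[of v] by (simp add: u_def degree_pderiv)
  have "degree (V * pderiv (pderiv u)) \<le> (N - 2) + (N - 2)"
    by (rule order.trans[OF degree_mult_le add_mono[OF deg dV]])
  then have "degree (V * pderiv (pderiv u)) \<le> 2 * N - 1" by simp
  from lgl_quadrature[OF N_ge_1 this]
  have Q1: "(\<Sum>i\<in>{1..<N}. lgl_weight N i * (poly V (lgl_node N i) * poly (pderiv (pderiv u)) (lgl_node N i)))
    = integ (V * pderiv (pderiv u))
      - w * (poly V 1 * poly (pderiv (pderiv u)) 1 + poly V (-1) * poly (pderiv (pderiv u)) (-1))"
    unfolding sum_nodes_split
    unfolding lgl_weight_ends w_def[symmetric]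
    by (simp add: lgl_node_0[OF N_ge_1] lgl_node_N[OF N_ge_1] algebra_simps)
  have "degree (u * V) \<le> N + (N - 2)"
    using degree_interpolant[of v]
    by (intro order.trans[OF degree_mult_le] add_mono deg) (simp add: u_def)
  then have "degree (u * V) \<le> 2 * N - 1" using N by simp
  from lgl_quadrature[OF N_ge_1 this]
  have Q2: "integ (u * V) = (\<Sum>i\<in>{1..<N}. lgl_weight N i * (poly u (lgl_node N i) * poly V (lgl_node N i)))"
    unfolding sum_nodes_split
    by (simp add: lgl_node_0[OF N_ge_1] lgl_node_N[OF N_ge_1] interpolant_ends u_def)
  \<comment> \<open>Integration by parts in closed form: the integrand is the derivative of
    \<open>- V u' - x V^2\<close>, whose end values produce the two squares.\<close>
  have "integ (- (V * pderiv (pderiv u)) - omega * (pderiv V * pderiv V) - V * V)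
      = (poly V 1)\<^sup>2 + (poly V (-1))\<^sup>2"
    by (subst integ_eqI[of "- (V * pderiv u) - [:0, 1:] * (V * V)"])
       (simp_all add: uV pderiv_rules power2_eq_square algebra_simps)
  then have I: "- integ (V * pderiv (pderiv u))
      = integ (omega * (pderiv V * pderiv V)) + integ (V * V) + (poly V 1)\<^sup>2 + (poly V (-1))\<^sup>2"
    by (simp only: integ_diff integ_minus)
  have "0 \<le> integ (V * V - u * V)"
  proof (rule integ_nonneg)
    fix x
    have "poly (V * V - u * V) x = x\<^sup>2 * (poly V x)\<^sup>2"
      by (simp add: uV power2_eq_square algebra_simps)
    then show "0 \<le> poly (V * V - u * V) x" by simp
  qed
  then have uV_le: "integ (u * V) \<le> integ (V * V)" by (simp only: integ_diff)
  have uV_nonneg: "0 \<le> integ (u * V)"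
    unfolding Q2
  proof (rule sum_nonneg)
    fix i assume i: "i \<in> {1..<N}"
    have "poly u (lgl_node N i) * poly V (lgl_node N i) = (1 - (lgl_node N i)\<^sup>2) * (poly V (lgl_node N i))\<^sup>2"
      by (simp add: uV power2_eq_square algebra_simps)
    then show "0 \<le> lgl_weight N i * (poly u (lgl_node N i) * poly V (lgl_node N i))"
      using pos[OF i] lgl_weight_nonneg[of i] i by simp
  qed
  have "(\<Sum>i\<in>{1..<N}. lgl_weight N i / (1 - (lgl_node N i)\<^sup>2) * (v i)\<^sup>2) = integ (u * V)"
    unfolding Q2
    by (intro sum.cong refl)
       (use poly_interpolant in \<open>simp add: quotient u_def power2_eq_square\<close>)
  moreover have "(\<Sum>i\<in>{1..<N}. lgl_weight N i / (1 - (lgl_node N i)\<^sup>2) *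
      (v i * - poly (pderiv (pderiv u)) (lgl_node N i)))
    = - (\<Sum>i\<in>{1..<N}. lgl_weight N i * (poly V (lgl_node N i) * poly (pderiv (pderiv u)) (lgl_node N i)))"
    unfolding sum_negf[symmetric] by (intro sum.cong refl) (simp add: quotient)
  moreover have "integ (V * V) \<le> - (\<Sum>i\<in>{1..<N}. lgl_weight N i * (poly V (lgl_node N i) * poly (pderiv (pderiv u)) (lgl_node N i)))"
    using end_term_bound[OF deg] I
    unfolding Q1 u2 w_def[symmetric] by (simp add: power2_eq_square algebra_simps)
  \<comment> \<open>The estimate holds with constant 1, as
    \<open>u V = (1 - x^2) V^2 <= V^2\<close>; it is relaxed to 1/4 to match
    \<open>coercive_unweighted\<close>.\<close>
  ultimately show ?thesis using uV_le uV_nonneg by (simp add: u_def)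
qed

text \<open>The two preceding estimates cover the quadrature weights multiplied by 1 and by
  \<open>X^2\<close>. \<open>interpolate_weighted_forms\<close> gives the same for the factor
  \<open>X\<close>, and \<open>lgl_weight_ratio_bounds\<close> shows that these last weights are
  constant up to the factor 9/8.\<close>

lemma coercive_euclidean:
  "\<exists>\<theta>. (\<forall>i\<in>{1..<N}. 1 \<le> \<theta> i \<and> \<theta> i \<le> 9 / 8) \<and>
    (\<forall>v. 1 / 4 * (\<Sum>i\<in>{1..<N}. \<theta> i * (v i)\<^sup>2)
      \<le> (\<Sum>i\<in>{1..<N}. \<theta> i * (v i * - poly (pderiv (pderiv (interpolant v))) (lgl_node N i))))"
proof -
  define I where "I = {1..<N}"
  define g where "g i j = - poly (pderiv (pderiv (lagrange_basis N j))) (lgl_node N i)" for i j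
  define X where "X i = 1 / sqrt (1 - (lgl_node N i)\<^sup>2)" for i
  \<comment> \<open>Subtracting 1/4 on the diagonal turns coercivity into nonnegativity, so the
    interpolation applies and the constant 1/4 survives it.\<close>
  define s where "s i j = lgl_weight N i * (g i j - (if i = j then 1 / 4 else 0))" for i j
  have pos: "0 < 1 - (lgl_node N i)\<^sup>2" if "i \<in> I" for i
    using omega_pos[of "lgl_node N i"] lgl_node_interior[of i N] that by (simp add: I_def)
  have second: "- poly (pderiv (pderiv (interpolant v))) x
      = (\<Sum>j\<in>I. - poly (pderiv (pderiv (lagrange_basis N j))) x * v j)" for v x
    by (simp add: interpolant_def I_def higher_pderiv_sum[of 1, simplified] pderiv_smult poly_sum
      sum_negf mult.commute)
  have form: "(\<Sum>i\<in>I. \<Sum>j\<in>I. c i * s i j * v i * v j)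
    = (\<Sum>i\<in>I. c i * lgl_weight N i * (v i * - poly (pderiv (pderiv (interpolant v))) (lgl_node N i)))
      - 1 / 4 * (\<Sum>i\<in>I. c i * lgl_weight N i * (v i)\<^sup>2)" for c v
  proof -
    have "(\<Sum>j\<in>I. c i * s i j * v i * v j)
      = c i * lgl_weight N i * (v i * - poly (pderiv (pderiv (interpolant v))) (lgl_node N i))
        - 1 / 4 * (c i * lgl_weight N i * (v i)\<^sup>2)" if "i \<in> I" for i
    proof -
      have "(\<Sum>j\<in>I. c i * s i j * v i * v j)
        = (\<Sum>j\<in>I. c i * lgl_weight N i * v i * (g i j * v j))
          - (\<Sum>j\<in>I. if i = j then c i * lgl_weight N i * v i * (1 / 4 * v j) else 0)"
        unfolding sum_subtractf[symmetric]
        by (rule sum.cong) (auto simp: s_def algebra_simps)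
      also have "(\<Sum>j\<in>I. c i * lgl_weight N i * v i * (g i j * v j))
        = c i * lgl_weight N i * (v i * - poly (pderiv (pderiv (interpolant v))) (lgl_node N i))"
        unfolding second g_def by (simp add: sum_distrib_left mult.assoc)
      finally show ?thesis using that by (simp add: I_def power2_eq_square)
    qed
    then show ?thesis by (simp add: sum_subtractf sum_distrib_left)
  qed
  have X2: "(X i)\<^sup>2 * lgl_weight N i = lgl_weight N i / (1 - (lgl_node N i)\<^sup>2)" if "i \<in> I" for i
    using pos[OF that] by (simp add: X_def power_divide)
  have 0: "0 \<le> (\<Sum>i\<in>I. \<Sum>j\<in>I. s i j * v i * v j)" for v
    using form[of "\<lambda>_. 1" v] coercive_unweighted[of v] by (simp add: I_def)
  have 2: "0 \<le> (\<Sum>i\<in>I. \<Sum>j\<in>I. (X i)\<^sup>2 * s i j * v i * v j)" for v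
    using form[of "\<lambda>i. (X i)\<^sup>2" v] coercive_singular_weight[of v, folded I_def]
    by (simp add: X2 cong: sum.cong)
  have X: "0 < X i" if "i \<in> I" for i using pos[OF that] by (simp add: X_def)
  have 1: "0 \<le> (\<Sum>i\<in>I. \<Sum>j\<in>I. X i * s i j * v i * v j)" for v
    by (rule interpolate_weighted_forms[OF X 0 2])
  obtain t where t: "0 < t" and ratio: "\<And>i. i \<in> I \<Longrightarrow> 1 \<le> t * (lgl_weight N i / sqrt (1 - (lgl_node N i)\<^sup>2)) \<and>
    t * (lgl_weight N i / sqrt (1 - (lgl_node N i)\<^sup>2)) \<le> 9 / 8"
    using lgl_weight_ratio_bounds[OF N] by (auto simp: I_def)
  define \<theta> where "\<theta> i = t * (X i * lgl_weight N i)" for i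
  have "1 \<le> \<theta> i \<and> \<theta> i \<le> 9 / 8" if "i \<in> I" for i
    using ratio[OF that] by (simp add: \<theta>_def X_def)
  moreover have "1 / 4 * (\<Sum>i\<in>I. \<theta> i * (v i)\<^sup>2)
      \<le> (\<Sum>i\<in>I. \<theta> i * (v i * - poly (pderiv (pderiv (interpolant v))) (lgl_node N i)))" for v
  proof -
    have "0 \<le> t * ((\<Sum>i\<in>I. X i * lgl_weight N i * (v i * - poly (pderiv (pderiv (interpolant v))) (lgl_node N i)))
      - 1 / 4 * (\<Sum>i\<in>I. X i * lgl_weight N i * (v i)\<^sup>2))"
      using 1[of v] t unfolding form by simp
    also have "\<dots> = (\<Sum>i\<in>I. \<theta> i * (v i * - poly (pderiv (pderiv (interpolant v))) (lgl_node N i)))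
      - 1 / 4 * (\<Sum>i\<in>I. \<theta> i * (v i)\<^sup>2)"
      by (simp add: \<theta>_def right_diff_distrib sum_distrib_left mult.assoc mult.left_commute)
    finally show ?thesis by simp
  qed
  ultimately show ?thesis unfolding I_def by blast
qed

end

subsection \<open>Inverses and norms of matrices\<close>

lemma inv_mat_unique:
  assumes A: "A \<in> carrier_mat n n" and B: "B \<in> carrier_mat n n" and AB: "A * B = 1\<^sub>m n"
  shows "inv_mat A = B" "invertible_mat A"
proof -
  have BA: "B * A = 1\<^sub>m n" by (rule mat_mult_left_right_inverse[OF A B AB])
  then show "invertible_mat A"
    using A B AB by (auto simp: invertible_mat_def inverts_mat_def)
  have "A \<in> Units (ring_mat TYPE(real) n ())"
    using A B AB BA by (auto simp: Units_def ring_mat_def)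
  then obtain C where "mat_inverse A = Some C"
    using mat_inverse(1)[OF A, of "()"] by (cases "mat_inverse A") auto
  moreover from mat_inverse(2)[OF A this] have "C = B"
    using A B AB by (metis assoc_mult_mat left_mult_one_mat right_mult_one_mat)
  ultimately show "inv_mat A = B" by (simp add: inv_mat_def)
qed

lemma inv_mat_injective:
  assumes A: "A \<in> carrier_mat n n"
    and inj: "\<And>v. v \<in> carrier_vec n \<Longrightarrow> A *\<^sub>v v = 0\<^sub>v n \<Longrightarrow> v = 0\<^sub>v n"
  shows "inv_mat A \<in> carrier_mat n n" "A * inv_mat A = 1\<^sub>m n" "inv_mat A * A = 1\<^sub>m n" "invertible_mat A"
proof -
  have "det A \<noteq> 0" using det_0_iff_vec_prod_zero[OF A] inj by blast
  then have "A \<in> Units (ring_mat TYPE(real) n ())"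
    by (rule det_non_zero_imp_unit[OF A])
  then obtain C where C: "mat_inverse A = Some C"
    using mat_inverse(1)[OF A, of "()"] by (cases "mat_inverse A") auto
  note inv = mat_inverse(2)[OF A C]
  have "inv_mat A = C" by (simp add: inv_mat_def C)
  then show "inv_mat A \<in> carrier_mat n n" "A * inv_mat A = 1\<^sub>m n" "inv_mat A * A = 1\<^sub>m n"
    using inv by auto
  show "invertible_mat A" using inv inv_mat_unique(2)[OF A] by blast
qed

section \<open>Euclidean norms of vectors and matrices\<close>

lemma vec_norm2_L2_set: "vec_norm2 v = L2_set (\<lambda>i. v $ i) {..<dim_vec v}"
  by (simp add: vec_norm2_def scalar_prod_def L2_set_def power2_eq_square atLeast0LessThan)

lemma vec_norm2_nonneg: "0 \<le> vec_norm2 v"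
  by (simp add: vec_norm2_L2_set)

lemma vec_norm2_square: "(vec_norm2 v)\<^sup>2 = (\<Sum>i<dim_vec v. (v $ i)\<^sup>2)"
  by (simp add: vec_norm2_L2_set L2_set_def sum_nonneg)

lemma vec_norm2_eq_0:
  assumes "v \<in> carrier_vec n" "vec_norm2 v = 0"
  shows "v = 0\<^sub>v n"
  using assms by (intro eq_vecI) (auto simp: vec_norm2_L2_set L2_set_eq_0_iff)

lemma vec_norm2_add_smult:
  assumes "v \<in> carrier_vec n" "w \<in> carrier_vec n"
  shows "vec_norm2 (v + c \<cdot>\<^sub>v w) \<le> vec_norm2 v + \<bar>c\<bar> * vec_norm2 w"
proof -
  have "L2_set (\<lambda>i. c * w $ i) {..<n} = \<bar>c\<bar> * L2_set (\<lambda>i. w $ i) {..<n}"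
    by (simp add: L2_set_def power_mult_distrib real_sqrt_mult flip: sum_distrib_left)
  moreover have "L2_set (\<lambda>i. (v + c \<cdot>\<^sub>v w) $ i) {..<n} = L2_set (\<lambda>i. v $ i + c * w $ i) {..<n}"
    by (rule L2_set_cong) (use assms in auto)
  ultimately show ?thesis
    using assms L2_set_triangle_ineq[of "\<lambda>i. v $ i" "\<lambda>i. c * w $ i" "{..<n}"]
    by (simp add: vec_norm2_L2_set)
qed

text \<open>\<open>mat_norm2\<close> is a supremum of reals, so its nonnegativity too rests on
  boundedness of the set, which the estimate with \<open>C\<close> supplies.\<close>

lemma mat_norm2_bounds:
  assumes A: "A \<in> carrier_mat m n" and C: "0 \<le> C"
    and bound: "\<And>v. v \<in> carrier_vec n \<Longrightarrow> vec_norm2 (A *\<^sub>v v) \<le> C * vec_norm2 v"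
  shows "0 \<le> mat_norm2 A" "mat_norm2 A \<le> C"
proof -
  define S where "S = {v \<in> carrier_vec (dim_col A). vec_norm2 v \<le> 1}"
  have le: "vec_norm2 (A *\<^sub>v v) \<le> C" if "v \<in> S" for v
    using bound[of v] that A C mult_left_le[of "vec_norm2 v" C] by (auto simp: S_def)
  have "vec_norm2 (0\<^sub>v n :: real vec) = 0" by (simp add: vec_norm2_def)
  then have S: "0\<^sub>v n \<in> S" using A by (simp add: S_def)
  show "mat_norm2 A \<le> C"
    unfolding mat_norm2_def S_def[symmetric] using S le by (intro cSUP_least) auto
  have "vec_norm2 (A *\<^sub>v 0\<^sub>v n) \<le> mat_norm2 A"
    unfolding mat_norm2_def S_def[symmetric]
    by (rule cSUP_upper[OF S]) (use le in \<open>auto intro!: bdd_aboveI\<close>)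
  then show "0 \<le> mat_norm2 A" using vec_norm2_nonneg[of "A *\<^sub>v 0\<^sub>v n"] by linarith
qed

subsection \<open>Kronecker products\<close>

text \<open>Kronecker products number a grid block by block: in \<open>p * m + q\<close> the block
  \<open>p\<close> belongs to the first factor and the position \<open>q\<close> to the
  second.\<close>

lemma sum_grid:
  fixes f :: "nat \<Rightarrow> real"
  shows "(\<Sum>k<n * m. f k) = (\<Sum>p<n. \<Sum>q<m. f (p * m + q))"
proof -
  have "(\<Sum>q<m. f (p * m + q)) = sum f {p * m..<p * m + m}" for p
    using sum.shift_bounds_nat_ivl[of f 0 "p * m" m]
    by (simp add: atLeast0LessThan add.commute)
  then show ?thesis by (simp add: sum.nat_group mult.commute)
qed

lemma grid_index:
  fixes p q n m :: nat
  assumes "p < n" "q < m"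
  shows "p * m + q < n * m" "(p * m + q) div m = p" "(p * m + q) mod m = q"
proof -
  have "p * m + q < Suc p * m" using assms by simp
  also have "\<dots> \<le> n * m" using assms by (intro mult_le_mono1) simp
  finally show "p * m + q < n * m" .
qed (use assms in simp_all)

lemma kronecker_carrier:
  assumes "A \<in> carrier_mat r c" "B \<in> carrier_mat r' c'"
  shows "A \<otimes>\<^sub>K B \<in> carrier_mat (r * r') (c * c')"
  using assms by (auto simp: kronecker_def)

lemma index_kronecker:
  assumes "A \<in> carrier_mat r c" "B \<in> carrier_mat r' c'" "i < r * r'" "j < c * c'"
  shows "(A \<otimes>\<^sub>K B) $$ (i, j) = A $$ (i div r', j div c') * B $$ (i mod r', j mod c')"
  using assms by (auto simp: kronecker_def)

lemma div_mod_less: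
  fixes i r r' :: nat
  assumes "i < r * r'"
  shows "i div r' < r" "i mod r' < r'"
proof -
  have "0 < r'" using assms by (cases r') auto
  then show "i div r' < r" "i mod r' < r'"
    using assms by (simp_all add: less_mult_imp_div_less)
qed

text \<open>Once \<open>sum_grid\<close> has split the inner summation index into two, the double
  sum is a product of two sums.\<close>

lemma kronecker_mult:
  assumes A: "A \<in> carrier_mat n1 n2" and B: "B \<in> carrier_mat m1 m2"
    and C: "C \<in> carrier_mat n2 n3" and D: "D \<in> carrier_mat m2 m3"
  shows "(A \<otimes>\<^sub>K B) * (C \<otimes>\<^sub>K D) = (A * C) \<otimes>\<^sub>K (B * D)"
proof (rule eq_matI)
  note AB = kronecker_carrier[OF A B] and CD = kronecker_carrier[OF C D]
  have AC: "A * C \<in> carrier_mat n1 n3" and BD: "B * D \<in> carrier_mat m1 m3"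
    using A B C D by auto
  fix i j assume "i < dim_row ((A * C) \<otimes>\<^sub>K (B * D))" "j < dim_col ((A * C) \<otimes>\<^sub>K (B * D))"
  then have i: "i < n1 * m1" and j: "j < n3 * m3"
    using kronecker_carrier[OF AC BD] by auto
  note i' = div_mod_less[OF i] and j' = div_mod_less[OF j]
  have "((A \<otimes>\<^sub>K B) * (C \<otimes>\<^sub>K D)) $$ (i, j) = (\<Sum>k<n2 * m2. (A \<otimes>\<^sub>K B) $$ (i, k) * (C \<otimes>\<^sub>K D) $$ (k, j))"
    using AB CD i j by (simp add: scalar_prod_def atLeast0LessThan)
  also have "\<dots> = (\<Sum>k<n2 * m2. (A $$ (i div m1, k div m2) * B $$ (i mod m1, k mod m2)) *
      (C $$ (k div m2, j div m3) * D $$ (k mod m2, j mod m3)))"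
    by (rule sum.cong) (simp_all add: index_kronecker[OF A B i] index_kronecker[OF C D _ j])
  also have "\<dots> = (\<Sum>p<n2. \<Sum>q<m2. (A $$ (i div m1, p) * C $$ (p, j div m3)) *
      (B $$ (i mod m1, q) * D $$ (q, j mod m3)))"
    unfolding sum_grid by (intro sum.cong refl) (simp add: grid_index)
  also have "\<dots> = (\<Sum>p<n2. A $$ (i div m1, p) * C $$ (p, j div m3)) *
      (\<Sum>q<m2. B $$ (i mod m1, q) * D $$ (q, j mod m3))"
    by (simp add: sum_product)
  also have "\<dots> = (A * C) $$ (i div m1, j div m3) * (B * D) $$ (i mod m1, j mod m3)"
    using A B C D i' j' by (simp add: scalar_prod_def atLeast0LessThan)
  also have "\<dots> = ((A * C) \<otimes>\<^sub>K (B * D)) $$ (i, j)"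
    by (simp add: index_kronecker[OF AC BD i j])
  finally show "((A \<otimes>\<^sub>K B) * (C \<otimes>\<^sub>K D)) $$ (i, j) = ((A * C) \<otimes>\<^sub>K (B * D)) $$ (i, j)" .
qed (use kronecker_carrier[OF A B] kronecker_carrier[OF C D] kronecker_carrier[OF mult_carrier_mat[OF A C] mult_carrier_mat[OF B D]] in auto)

lemma kronecker_one: "1\<^sub>m n \<otimes>\<^sub>K 1\<^sub>m m = 1\<^sub>m (n * m)"
proof (rule eq_matI)
  fix i j assume "i < dim_row (1\<^sub>m (n * m) :: real mat)" "j < dim_col (1\<^sub>m (n * m) :: real mat)"
  then have i: "i < n * m" and j: "j < n * m" by auto
  have "i div m = j div m \<and> i mod m = j mod m \<longleftrightarrow> i = j"
    by (metis div_mult_mod_eq)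
  then show "(1\<^sub>m n \<otimes>\<^sub>K 1\<^sub>m m) $$ (i, j) = (1\<^sub>m (n * m) :: real mat) $$ (i, j)"
    using div_mod_less[OF i] div_mod_less[OF j] i j
    by (auto simp: index_kronecker[OF one_carrier_mat one_carrier_mat])
qed (auto simp: kronecker_def)

lemma kronecker_mult_vec:
  assumes A: "A \<in> carrier_mat n n" and B: "B \<in> carrier_mat n n" and v: "v \<in> carrier_vec (n * n)"
    and pq: "p < n" "q < n"
  shows "((A \<otimes>\<^sub>K B) *\<^sub>v v) $ (p * n + q) = (\<Sum>r<n. \<Sum>t<n. A $$ (p, r) * B $$ (q, t) * v $ (r * n + t))"
proof -
  have "((A \<otimes>\<^sub>K B) *\<^sub>v v) $ (p * n + q) = (\<Sum>k<n * n. (A \<otimes>\<^sub>K B) $$ (p * n + q, k) * v $ k)"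
    using kronecker_carrier[OF A B] v grid_index(1)[OF pq]
    by (simp add: scalar_prod_def atLeast0LessThan)
  also have "\<dots> = (\<Sum>r<n. \<Sum>t<n. A $$ (p, r) * B $$ (q, t) * v $ (r * n + t))"
    unfolding sum_grid
    by (intro sum.cong refl) (simp add: index_kronecker[OF A B] grid_index pq)
  finally show ?thesis .
qed

subsection \<open>Birkhoff and Lagrange differentiation matrices\<close>

lemma D2_carrier: "D2_mat N \<in> carrier_mat (N - 1) (N - 1)"
  by (simp add: D2_mat_def)

lemma B_carrier: "B_mat N \<in> carrier_mat (N - 1) (N - 1)"
  by (simp add: B_mat_def)

lemma coeff_carrier: "coeff_mat N f \<in> carrier_mat (N - 1) (N - 1)"
  by (simp add: coeff_mat_def)

lemma sum_interior:
  fixes f :: "nat \<Rightarrow> real"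
  assumes "2 \<le> N"
  shows "(\<Sum>i\<in>{1..<N}. f i) = (\<Sum>i<N - 1. f (Suc i))"
  using sum.shift_bounds_Suc_ivl[of f 0 "N - 1"] assms by (simp add: atLeast0LessThan)

lemma interpolant_second_deriv:
  assumes N: "2 \<le> N" and i: "i < N - 1"
  shows "poly (pderiv (pderiv (interpolant N v))) (lgl_node N (Suc i))
    = (\<Sum>j<N - 1. D2_mat N $$ (i, j) * v (Suc j))"
proof -
  have "poly (pderiv (pderiv (interpolant N v))) (lgl_node N (Suc i))
    = (\<Sum>j\<in>{1..<N}. v j * poly (pderiv (pderiv (lagrange_basis N j))) (lgl_node N (Suc i)))"
    by (simp add: interpolant_def[OF N] higher_pderiv_sum[of 1, simplified] pderiv_smult poly_sum)
  also have "\<dots> = (\<Sum>j<N - 1. D2_mat N $$ (i, j) * v (Suc j))"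
    unfolding sum_interior[OF N]
    by (rule sum.cong) (use i in \<open>auto simp: D2_mat_def mult.commute\<close>)
  finally show ?thesis .
qed

text \<open>\<open>coercive_euclidean\<close> in matrix indices: index \<open>i\<close> belongs to
  node \<open>i + 1\<close>, which accounts for all the shifts.\<close>

lemma D2_coercive:
  assumes N: "2 \<le> N"
  shows "\<exists>\<theta>. (\<forall>i<N - 1. 1 \<le> \<theta> i \<and> \<theta> i \<le> 9 / 8) \<and>
    (\<forall>u. 1 / 4 * (\<Sum>i<N - 1. \<theta> i * (u i)\<^sup>2)
      \<le> (\<Sum>i<N - 1. \<theta> i * (u i * - (\<Sum>j<N - 1. D2_mat N $$ (i, j) * u j))))"
proof -
  obtain \<theta> where \<theta>: "\<And>i. i \<in> {1..<N} \<Longrightarrow> 1 \<le> \<theta> i \<and> \<theta> i \<le> 9 / 8"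
    and coercive: "\<And>v. 1 / 4 * (\<Sum>i\<in>{1..<N}. \<theta> i * (v i)\<^sup>2)
      \<le> (\<Sum>i\<in>{1..<N}. \<theta> i * (v i * - poly (pderiv (pderiv (interpolant N v))) (lgl_node N i)))"
    using coercive_euclidean[OF N] by blast
  show ?thesis
  proof (intro exI[of _ "\<lambda>i. \<theta> (Suc i)"] conjI allI impI)
    fix i assume "i < N - 1"
    then show "1 \<le> \<theta> (Suc i)" "\<theta> (Suc i) \<le> 9 / 8" using \<theta>[of "Suc i"] by auto
  next
    fix u :: "nat \<Rightarrow> real"
    show "1 / 4 * (\<Sum>i<N - 1. \<theta> (Suc i) * (u i)\<^sup>2)
      \<le> (\<Sum>i<N - 1. \<theta> (Suc i) * (u i * - (\<Sum>j<N - 1. D2_mat N $$ (i, j) * u j)))"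
    proof -
      have "(\<Sum>i<N - 1. \<theta> (Suc i) * (u i * - poly (pderiv (pderiv (interpolant N (\<lambda>i. u (i - 1))))) (lgl_node N (Suc i))))
        = (\<Sum>i<N - 1. \<theta> (Suc i) * (u i * - (\<Sum>j<N - 1. D2_mat N $$ (i, j) * u j)))"
        by (intro sum.cong refl) (simp add: interpolant_second_deriv[OF N] del: One_nat_def)
      then show ?thesis
        using coercive[of "\<lambda>i. u (i - 1)"] unfolding sum_interior[OF N] by simp
    qed
  qed
qed

text \<open>If the image is zero, coercivity bounds a sum of squares with positive weights by
  0.\<close>

lemma D2_injective:
  assumes N: "2 \<le> N" and zero: "\<And>i. i < N - 1 \<Longrightarrow> (\<Sum>j<N - 1. D2_mat N $$ (i, j) * u j) = 0"
    and i: "i < N - 1"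
  shows "u i = 0"
proof -
  obtain \<theta> where \<theta>: "\<And>i. i < N - 1 \<Longrightarrow> 1 \<le> \<theta> i"
    and coercive: "1 / 4 * (\<Sum>i<N - 1. \<theta> i * (u i)\<^sup>2)
      \<le> (\<Sum>i<N - 1. \<theta> i * (u i * - (\<Sum>j<N - 1. D2_mat N $$ (i, j) * u j)))"
    using D2_coercive[OF N] by blast
  have "(\<Sum>i<N - 1. \<theta> i * (u i)\<^sup>2) \<le> 0" using coercive zero by simp
  moreover have nonneg: "0 \<le> \<theta> i * (u i)\<^sup>2" if "i < N - 1" for i
    using \<theta>[OF that] by (intro mult_nonneg_nonneg) auto
  moreover have "0 \<le> (\<Sum>i<N - 1. \<theta> i * (u i)\<^sup>2)"
    by (rule sum_nonneg) (simp add: nonneg del: One_nat_def)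
  ultimately have "(\<Sum>i<N - 1. \<theta> i * (u i)\<^sup>2) = 0" by linarith
  then have "\<theta> i * (u i)\<^sup>2 = 0"
    using sum_nonneg_0[of "{..<N - 1}" "\<lambda>i. \<theta> i * (u i)\<^sup>2" i] nonneg i by auto
  then show ?thesis using \<theta>[OF i] by auto
qed

lemma D2_inverse:
  assumes N: "2 \<le> N"
  shows "inv_mat (D2_mat N) \<in> carrier_mat (N - 1) (N - 1)"
    "D2_mat N * inv_mat (D2_mat N) = 1\<^sub>m (N - 1)" "inv_mat (D2_mat N) * D2_mat N = 1\<^sub>m (N - 1)"
proof -
  have "v = 0\<^sub>v (N - 1)" if v: "v \<in> carrier_vec (N - 1)" "D2_mat N *\<^sub>v v = 0\<^sub>v (N - 1)" for v
  proof (rule eq_vecI)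
    fix i assume "i < dim_vec (0\<^sub>v (N - 1) :: real vec)"
    then have i: "i < N - 1" by simp
    have "(\<Sum>j<N - 1. D2_mat N $$ (k, j) * v $ j) = 0" if "k < N - 1" for k
    proof -
      have "(D2_mat N *\<^sub>v v) $ k = (\<Sum>j<N - 1. D2_mat N $$ (k, j) * v $ j)"
        using that v(1) D2_carrier[of N] by (simp add: scalar_prod_def atLeast0LessThan)
      then show ?thesis using v(2) that by simp
    qed
    then show "v $ i = 0\<^sub>v (N - 1) $ i"
      using D2_injective[OF N, of "\<lambda>j. v $ j"] i by simp
  qed (use v in simp)
  from inv_mat_injective[OF D2_carrier this]
  show "inv_mat (D2_mat N) \<in> carrier_mat (N - 1) (N - 1)"
    "D2_mat N * inv_mat (D2_mat N) = 1\<^sub>m (N - 1)" "inv_mat (D2_mat N) * D2_mat N = 1\<^sub>m (N - 1)"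
    by auto
qed

lemma poly_eq_interpolant:
  assumes N: "2 \<le> N" and p: "degree p \<le> N" "poly p (-1) = 0" "poly p 1 = 0"
  shows "p = interpolant N (\<lambda>i. poly p (lgl_node N i))"
proof (rule poly_eq_if_agree_on_nodes[OF inj_lgl_node p(1) degree_interpolant[OF N]])
  show N_ge_1: "1 \<le> N" using N by simp
  fix i assume i: "i \<le> N"
  consider "i = 0" | "i = N" | "i \<in> {1..<N}" using i by force
  then show "poly p (lgl_node N i) = poly (interpolant N (\<lambda>i. poly p (lgl_node N i))) (lgl_node N i)"
    using poly_interpolant[OF N i] p(2,3) lgl_node_0[OF N_ge_1] lgl_node_N[OF N_ge_1]
    by cases auto
qed

text \<open>Interpolating column \<open>j\<close> of the inverse at the interior nodes gives a
  polynomial with the properties required in \<open>birkhoff_basis N (j + 1)\<close>.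
  \<open>D2_injective\<close> makes it the only one, so the definite description denotes it.\<close>

lemma B_mat_eq:
  assumes N: "2 \<le> N"
  shows "B_mat N = inv_mat (D2_mat N)"
proof (rule eq_matI)
  note E = D2_inverse[OF N]
  fix i j assume "i < dim_row (inv_mat (D2_mat N))" "j < dim_col (inv_mat (D2_mat N))"
  then have i: "i < N - 1" and j: "j < N - 1" using E(1) by auto
  let ?P = "\<lambda>p. degree p \<le> N \<and> poly p (-1) = 0 \<and> poly p 1 = 0 \<and>
        (\<forall>k\<in>{1..N-1}. poly (pderiv (pderiv p)) (lgl_node N k) = (if k = j + 1 then 1 else 0))"
  \<comment> \<open>Interior nodes are counted from 1 and rows from 0, hence
    \<open>k - 1\<close>.\<close>
  define p where "p = interpolant N (\<lambda>k. inv_mat (D2_mat N) $$ (k - 1, j))"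
  have "poly (pderiv (pderiv p)) (lgl_node N k) = (if k = j + 1 then 1 else 0)" if "k \<in> {1..N-1}" for k
  proof -
    obtain l where l: "k = Suc l" "l < N - 1" using \<open>k \<in> _\<close> by (cases k) auto
    have "(\<Sum>m<N - 1. D2_mat N $$ (l, m) * inv_mat (D2_mat N) $$ (m, j))
      = (D2_mat N * inv_mat (D2_mat N)) $$ (l, j)"
      using D2_carrier[of N] E(1) l j by (simp add: scalar_prod_def atLeast0LessThan)
    then show ?thesis
      using l j by (simp add: p_def interpolant_second_deriv[OF N] E(2))
  qed
  then have P: "?P p"
    using degree_interpolant[OF N] interpolant_ends[OF N] by (simp add: p_def)
  moreover have "q = p" if q: "?P q" for q
  proof -
    define r where "r = q - p"
    have r: "degree r \<le> N" "poly r (-1) = 0" "poly r 1 = 0"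
      using P q by (auto simp: r_def intro: degree_diff_le)
    have zero: "poly (pderiv (pderiv r)) (lgl_node N (Suc k)) = 0" if "k < N - 1" for k
      using P q that by (auto simp: r_def pderiv_diff)
    have r_eq: "r = interpolant N (\<lambda>i. poly r (lgl_node N i))"
      by (rule poly_eq_interpolant[OF N r])
    have "(\<Sum>m<N - 1. D2_mat N $$ (k, m) * poly r (lgl_node N (Suc m))) = 0" if "k < N - 1" for k
      using zero[OF that] interpolant_second_deriv[OF N that, of "\<lambda>i. poly r (lgl_node N i)"] r_eq
      by simp
    then have "poly r (lgl_node N (Suc k)) = 0" if "k < N - 1" for k
      using D2_injective[OF N, of "\<lambda>m. poly r (lgl_node N (Suc m))"] that by blast
    then have "poly r (lgl_node N k) = 0" if "k \<in> {1..<N}" for k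
      using that by (cases k) auto
    then have "r = 0"
      by (subst r_eq) (simp add: interpolant_def[OF N])
    then show ?thesis by (simp add: r_def)
  qed
  ultimately have "birkhoff_basis N (j + 1) = p"
    unfolding birkhoff_basis_def by (rule the_equality)
  then show "B_mat N $$ (i, j) = inv_mat (D2_mat N) $$ (i, j)"
    using i j poly_interpolant[OF N, of "Suc i"] by (simp add: B_mat_def p_def)
qed (use D2_inverse[OF N] B_carrier[of N] in auto)

lemma D2_B: "2 \<le> N \<Longrightarrow> D2_mat N * B_mat N = 1\<^sub>m (N - 1)"
  by (simp add: B_mat_eq D2_inverse)

subsection \<open>Stability of the two-dimensional operator\<close>

text \<open>Test \<open>f\<close> with \<open>c p q * u p q\<close>. Since
  \<open>c p q * a q\<close> is \<open>\<theta> q\<close> times a factor that depends on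
  \<open>p\<close> only, the one-dimensional coercivity applies within each row; by symmetry it
  applies within each column.\<close>

lemma two_dim_stability:
  fixes D :: "nat \<Rightarrow> nat \<Rightarrow> real"
  assumes \<theta>: "\<And>i. i < n \<Longrightarrow> 1 \<le> \<theta> i \<and> \<theta> i \<le> 9 / 8"
    and coercive: "\<And>u. 1 / 4 * (\<Sum>i<n. \<theta> i * (u i)\<^sup>2)
      \<le> (\<Sum>i<n. \<theta> i * (u i * - (\<Sum>j<n. D i j * u j)))"
    and \<alpha>: "0 < \<alpha>"
    and a: "\<And>i. i < n \<Longrightarrow> \<alpha> \<le> a i \<and> a i \<le> \<beta>" and b: "\<And>i. i < n \<Longrightarrow> \<alpha> \<le> b i \<and> b i \<le> \<beta>"
    and s: "0 \<le> s"
    and f: "\<And>p q. p < n \<Longrightarrow> q < n \<Longrightarrow> f p q =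
      - (a q * (\<Sum>t<n. D q t * u p t)) - b p * (\<Sum>r<n. D p r * u r q) + s * u p q"
  shows "(\<Sum>p<n. \<Sum>q<n. (u p q)\<^sup>2) \<le> 4 * \<beta> / \<alpha>\<^sup>2 * (\<Sum>p<n. \<Sum>q<n. \<bar>u p q\<bar> * \<bar>f p q\<bar>)"
proof (cases "n = 0")
  case False
  then have \<beta>: "0 < \<beta>" using a[of 0] \<alpha> by simp
  define c where "c p q = \<theta> p * \<theta> q / (a q * b p)" for p q
  have ab: "0 < a i" "0 < b i" "0 < \<theta> i" if "i < n" for i
    using a[OF that] b[OF that] \<theta>[OF that] \<alpha> by auto
  have c_eq: "\<theta> p / b p * (\<theta> q * (x * - y)) = c p q * (x * - (a q * y))"
    "\<theta> q / a q * (\<theta> p * (x * - y)) = c p q * (x * - (b p * y))" if "p < n" "q < n" for p q x y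
    using ab(1)[OF that(2)] ab(2)[OF that(1)] by (simp_all add: c_def)
  have weighted: "x\<^sup>2 \<le> \<theta> i * x\<^sup>2" if "i \<in> {..<n}" for i x
    using mult_right_mono[of 1 "\<theta> i" "x\<^sup>2"] \<theta>[of i] that by simp
  \<comment> \<open>The 2 is a generous bound for \<open>(9 / 8)^2\<close>.\<close>
  have c_bounds: "0 \<le> c p q" "c p q \<le> 2 / \<alpha>\<^sup>2" if "p < n" "q < n" for p q
  proof -
    show "0 \<le> c p q" using ab(1)[OF that(2)] ab(2)[OF that(1)] ab(3)[OF that(1)] ab(3)[OF that(2)]
      by (simp add: c_def)
    have "\<theta> p * \<theta> q \<le> 9 / 8 * (9 / 8)" using \<theta> ab that by (intro mult_mono) (auto intro: less_imp_le)
    moreover have "\<alpha>\<^sup>2 \<le> a q * b p"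
      unfolding power2_eq_square
      using a[OF that(2)] b[OF that(1)] ab(1)[OF that(2)] \<alpha> by (intro mult_mono) auto
    ultimately show "c p q \<le> 2 / \<alpha>\<^sup>2"
      unfolding c_def using \<alpha> by (intro frac_le) auto
  qed
  have row: "1 / (4 * \<beta>) * (\<Sum>q<n. (u p q)\<^sup>2)
      \<le> (\<Sum>q<n. c p q * (u p q * - (a q * (\<Sum>t<n. D q t * u p t))))" if p: "p < n" for p
  proof -
    have "1 / (4 * \<beta>) * (\<Sum>q<n. (u p q)\<^sup>2) \<le> 1 / (4 * \<beta>) * (\<Sum>q<n. \<theta> q * (u p q)\<^sup>2)"
      using \<beta> by (intro mult_left_mono sum_mono weighted) auto
    also have "\<dots> = 1 / \<beta> * (1 / 4 * (\<Sum>q<n. \<theta> q * (u p q)\<^sup>2))" by simp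
    \<comment> \<open>Here \<open>1 <= \<theta> p\<close> and \<open>b p <= \<beta>\<close> enter;
      the factor \<open>\<theta> p / b p\<close> is constant along the row.\<close>
    also have "\<dots> \<le> \<theta> p / b p * (1 / 4 * (\<Sum>q<n. \<theta> q * (u p q)\<^sup>2))"
      using \<theta>[OF p] b[OF p] ab \<beta> p
      by (intro mult_right_mono frac_le mult_nonneg_nonneg sum_nonneg) (auto intro: less_imp_le)
    also have "\<dots> \<le> \<theta> p / b p * (\<Sum>q<n. \<theta> q * (u p q * - (\<Sum>t<n. D q t * u p t)))"
      using ab[OF p] by (intro mult_left_mono coercive) (auto intro: less_imp_le)
    also have "\<dots> = (\<Sum>q<n. c p q * (u p q * - (a q * (\<Sum>t<n. D q t * u p t))))"
      by (subst sum_distrib_left, intro sum.cong refl c_eq p) simp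
    finally show ?thesis .
  qed
  have column: "1 / (4 * \<beta>) * (\<Sum>p<n. (u p q)\<^sup>2)
      \<le> (\<Sum>p<n. c p q * (u p q * - (b p * (\<Sum>r<n. D p r * u r q))))" if q: "q < n" for q
  proof -
    have "1 / (4 * \<beta>) * (\<Sum>p<n. (u p q)\<^sup>2) \<le> 1 / (4 * \<beta>) * (\<Sum>p<n. \<theta> p * (u p q)\<^sup>2)"
      using \<beta> by (intro mult_left_mono sum_mono weighted) auto
    also have "\<dots> = 1 / \<beta> * (1 / 4 * (\<Sum>p<n. \<theta> p * (u p q)\<^sup>2))" by simp
    also have "\<dots> \<le> \<theta> q / a q * (1 / 4 * (\<Sum>p<n. \<theta> p * (u p q)\<^sup>2))"
      using \<theta>[OF q] a[OF q] ab \<beta> q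
      by (intro mult_right_mono frac_le mult_nonneg_nonneg sum_nonneg) (auto intro: less_imp_le)
    also have "\<dots> \<le> \<theta> q / a q * (\<Sum>p<n. \<theta> p * (u p q * - (\<Sum>r<n. D p r * u r q)))"
      using ab[OF q] by (intro mult_left_mono coercive) (auto intro: less_imp_le)
    also have "\<dots> = (\<Sum>p<n. c p q * (u p q * - (b p * (\<Sum>r<n. D p r * u r q))))"
      by (subst sum_distrib_left, intro sum.cong refl c_eq q) simp
    finally show ?thesis .
  qed
  \<comment> \<open>Rows and columns contribute \<open>1 / (4 * \<beta>)\<close> each; together with
    the bound on \<open>c\<close> this makes the final constant
    \<open>4 * \<beta> / \<alpha>^2\<close>.\<close>
  have "1 / (2 * \<beta>) * (\<Sum>p<n. \<Sum>q<n. (u p q)\<^sup>2)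
      = (\<Sum>p<n. 1 / (4 * \<beta>) * (\<Sum>q<n. (u p q)\<^sup>2)) + (\<Sum>q<n. 1 / (4 * \<beta>) * (\<Sum>p<n. (u p q)\<^sup>2))"
    unfolding sum_distrib_left[symmetric] by (subst (3) sum.swap) simp
  also have "\<dots> \<le> (\<Sum>p<n. \<Sum>q<n. c p q * (u p q * - (a q * (\<Sum>t<n. D q t * u p t))))
      + (\<Sum>q<n. \<Sum>p<n. c p q * (u p q * - (b p * (\<Sum>r<n. D p r * u r q))))"
    using row column by (intro add_mono sum_mono) auto
  also have "(\<Sum>q<n. \<Sum>p<n. c p q * (u p q * - (b p * (\<Sum>r<n. D p r * u r q))))
      = (\<Sum>p<n. \<Sum>q<n. c p q * (u p q * - (b p * (\<Sum>r<n. D p r * u r q))))"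
    by (rule sum.swap)
  also have "(\<Sum>p<n. \<Sum>q<n. c p q * (u p q * - (a q * (\<Sum>t<n. D q t * u p t)))) + \<dots>
      = (\<Sum>p<n. \<Sum>q<n. c p q * (u p q * (f p q - s * u p q)))"
    unfolding sum.distrib[symmetric]
    by (intro sum.cong refl) (simp add: f algebra_simps)
  also have "\<dots> \<le> (\<Sum>p<n. \<Sum>q<n. 2 / \<alpha>\<^sup>2 * (\<bar>u p q\<bar> * \<bar>f p q\<bar>))"
  proof (intro sum_mono)
    fix p q assume "p \<in> {..<n}" "q \<in> {..<n}"
    then have pq: "p < n" "q < n" by auto
    \<comment> \<open>The term with \<open>s\<close> has a favourable sign and is dropped, so the
      constant does not depend on \<open>s\<close>.\<close>
    have "u p q * (f p q - s * u p q) \<le> \<bar>u p q\<bar> * \<bar>f p q\<bar>"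
    proof -
      have "u p q * (f p q - s * u p q) = u p q * f p q - s * (u p q)\<^sup>2"
        by (simp add: power2_eq_square algebra_simps)
      moreover have "0 \<le> s * (u p q)\<^sup>2" using s by simp
      ultimately show ?thesis
        using abs_ge_self[of "u p q * f p q"] by (simp only: abs_mult)
    qed
    then have "c p q * (u p q * (f p q - s * u p q)) \<le> c p q * (\<bar>u p q\<bar> * \<bar>f p q\<bar>)"
      by (intro mult_left_mono c_bounds pq)
    also have "\<dots> \<le> 2 / \<alpha>\<^sup>2 * (\<bar>u p q\<bar> * \<bar>f p q\<bar>)"
      by (intro mult_right_mono c_bounds pq) simp
    finally show "c p q * (u p q * (f p q - s * u p q)) \<le> 2 / \<alpha>\<^sup>2 * (\<bar>u p q\<bar> * \<bar>f p q\<bar>)" .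
  qed
  also have "\<dots> = 2 / \<alpha>\<^sup>2 * (\<Sum>p<n. \<Sum>q<n. \<bar>u p q\<bar> * \<bar>f p q\<bar>)"
    by (simp add: sum_distrib_left)
  finally show ?thesis using \<beta> by (simp add: field_simps)
qed simp

subsection \<open>Condition numbers of the preconditioned matrices\<close>

declare One_nat_def [simp del]

section \<open>The Lagrange operator on grid functions\<close>

lemma mult_mat_vec_index:
  assumes "A \<in> carrier_mat n m" "v \<in> carrier_vec m" "i < n"
  shows "(A *\<^sub>v v) $ i = (\<Sum>j<m. A $$ (i, j) * v $ j)"
  using assms by (simp add: scalar_prod_def atLeast0LessThan)

lemma kronecker_one_left_mult_vec:
  assumes M: "M \<in> carrier_mat n n" and v: "v \<in> carrier_vec (n * n)" and pq: "p < n" "q < n"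
  shows "((1\<^sub>m n \<otimes>\<^sub>K M) *\<^sub>v v) $ (p * n + q) = (\<Sum>t<n. M $$ (q, t) * v $ (p * n + t))"
proof -
  have "(\<Sum>t<n. (1\<^sub>m n) $$ (p, r) * M $$ (q, t) * v $ (r * n + t))
      = (if p = r then \<Sum>t<n. M $$ (q, t) * v $ (p * n + t) else 0)" if "r < n" for r
    using that pq by simp
  then show ?thesis
    using pq by (simp add: kronecker_mult_vec[OF one_carrier_mat M v pq])
qed

lemma kronecker_one_right_mult_vec:
  assumes M: "M \<in> carrier_mat n n" and v: "v \<in> carrier_vec (n * n)" and pq: "p < n" "q < n"
  shows "((M \<otimes>\<^sub>K 1\<^sub>m n) *\<^sub>v v) $ (p * n + q) = (\<Sum>r<n. M $$ (p, r) * v $ (r * n + q))"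
proof -
  have "(\<Sum>t<n. M $$ (p, r) * (1\<^sub>m n) $$ (q, t) * v $ (r * n + t))
      = (\<Sum>t<n. if q = t then M $$ (p, r) * v $ (r * n + t) else 0)" for r
    by (rule sum.cong) (use pq in auto)
  then show ?thesis
    using pq by (simp add: kronecker_mult_vec[OF M one_carrier_mat v pq])
qed

lemma K_L_carrier: "K_L N a b \<in> carrier_mat ((N - 1) * (N - 1)) ((N - 1) * (N - 1))"
  unfolding K_L_def
  by (intro minus_carrier_mat kronecker_carrier one_carrier_mat
    mult_carrier_mat[OF coeff_carrier D2_carrier])

lemma coeff_mult_index:
  assumes M: "M \<in> carrier_mat (N - 1) (N - 1)" and "i < N - 1" "j < N - 1"
  shows "(coeff_mat N f * M) $$ (i, j) = f (lgl_node N (i + 1)) * M $$ (i, j)"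
  using assms by (simp add: coeff_mat_def mat_diag_mult_left[OF M])

text \<open>With \<open>v\<close> read as a grid function, \<open>p\<close> counts the nodes in the
  y direction and \<open>q\<close> those in the x direction: the first Kronecker factor acts on
  \<open>p\<close>, the second on \<open>q\<close>.\<close>

lemma K_L_mult_vec:
  fixes N :: nat
  defines "n \<equiv> N - 1"
  assumes v: "v \<in> carrier_vec (n * n)" and pq: "p < n" "q < n"
  shows "(K_L N a b *\<^sub>v v) $ (p * n + q)
    = - (a (lgl_node N (q + 1)) * (\<Sum>t<n. D2_mat N $$ (q, t) * v $ (p * n + t)))
      - b (lgl_node N (p + 1)) * (\<Sum>r<n. D2_mat N $$ (p, r) * v $ (r * n + q))"
proof -
  define X where "X = 1\<^sub>m n \<otimes>\<^sub>K (coeff_mat N a * D2_mat N)"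
  define Y where "Y = (coeff_mat N b * D2_mat N) \<otimes>\<^sub>K 1\<^sub>m n"
  have D: "D2_mat N \<in> carrier_mat n n" by (simp add: n_def D2_carrier)
  have CD: "coeff_mat N c * D2_mat N \<in> carrier_mat n n" for c
    using D coeff_carrier[of N c] by (auto simp: n_def)
  have X: "X \<in> carrier_mat (n * n) (n * n)" and Y: "Y \<in> carrier_mat (n * n) (n * n)"
    unfolding X_def Y_def by (intro kronecker_carrier one_carrier_mat CD)+
  note k = grid_index(1)[OF pq]
  have K: "K_L N a b \<in> carrier_mat (n * n) (n * n)" by (simp add: n_def K_L_carrier)
  have "(K_L N a b *\<^sub>v v) $ (p * n + q)
      = (\<Sum>j<n * n. - (X $$ (p * n + q, j) * v $ j) - Y $$ (p * n + q, j) * v $ j)"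
    unfolding mult_mat_vec_index[OF K v k]
    by (rule sum.cong)
       (use X Y k in \<open>simp_all add: K_L_def X_def[symmetric] Y_def[symmetric] n_def[symmetric] left_diff_distrib\<close>)
  also have "\<dots> = - ((X *\<^sub>v v) $ (p * n + q)) - (Y *\<^sub>v v) $ (p * n + q)"
    unfolding mult_mat_vec_index[OF X v k] mult_mat_vec_index[OF Y v k]
    by (simp add: sum_subtractf sum_negf)
  also have "(X *\<^sub>v v) $ (p * n + q) = (\<Sum>t<n. (coeff_mat N a * D2_mat N) $$ (q, t) * v $ (p * n + t))"
    unfolding X_def by (rule kronecker_one_left_mult_vec[OF CD v pq])
  also have "\<dots> = a (lgl_node N (q + 1)) * (\<Sum>t<n. D2_mat N $$ (q, t) * v $ (p * n + t))"
    unfolding sum_distrib_left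
    by (rule sum.cong) (use pq in \<open>simp_all add: coeff_mult_index[OF D2_carrier] n_def mult.assoc\<close>)
  also have "(Y *\<^sub>v v) $ (p * n + q) = (\<Sum>r<n. (coeff_mat N b * D2_mat N) $$ (p, r) * v $ (r * n + q))"
    unfolding Y_def by (rule kronecker_one_right_mult_vec[OF CD v pq])
  also have "\<dots> = b (lgl_node N (p + 1)) * (\<Sum>r<n. D2_mat N $$ (p, r) * v $ (r * n + q))"
    unfolding sum_distrib_left
    by (rule sum.cong) (use pq in \<open>simp_all add: coeff_mult_index[OF D2_carrier] n_def mult.assoc\<close>)
  finally show ?thesis .
qed

text \<open>\<open>two_dim_stability\<close> followed by Cauchy-Schwarz on its right side; one
  factor \<open>vec_norm2 v\<close> cancels. The constant involves neither \<open>N\<close> nor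
  \<open>s\<close>.\<close>

lemma K_L_stability:
  fixes N :: nat
  defines "n \<equiv> N - 1"
  assumes N: "2 \<le> N" and \<alpha>: "0 < \<alpha>"
    and a: "\<forall>x\<in>{-1..1}. \<alpha> \<le> a x \<and> a x \<le> \<beta>"
    and b: "\<forall>y\<in>{-1..1}. \<alpha> \<le> b y \<and> b y \<le> \<beta>"
    and s: "0 \<le> s"
    and v: "v \<in> carrier_vec (n * n)"
  shows "vec_norm2 v \<le> 4 * \<beta> / \<alpha>\<^sup>2 * vec_norm2 (K_L N a b *\<^sub>v v + s \<cdot>\<^sub>v v)"
proof -
  define f where "f = K_L N a b *\<^sub>v v + s \<cdot>\<^sub>v v"
  define R where "R = 4 * \<beta> / \<alpha>\<^sup>2"
  have K: "K_L N a b \<in> carrier_mat (n * n) (n * n)" by (simp add: n_def K_L_carrier)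
  have f: "f \<in> carrier_vec (n * n)" using K v by (simp add: f_def)
  have node: "lgl_node N (i + 1) \<in> {-1..1}" if "i < n" for i
    using lgl_node_bounds[of N "i + 1"] that N by (auto simp: n_def)
  have R: "0 \<le> R" using bspec[OF a, of 0] \<alpha> by (simp add: R_def)
  obtain \<theta> where \<theta>: "\<And>i. i < n \<Longrightarrow> 1 \<le> \<theta> i \<and> \<theta> i \<le> 9 / 8"
    and coercive: "\<And>u. 1 / 4 * (\<Sum>i<n. \<theta> i * (u i)\<^sup>2)
      \<le> (\<Sum>i<n. \<theta> i * (u i * - (\<Sum>j<n. D2_mat N $$ (i, j) * u j)))"
    using D2_coercive[OF N] unfolding n_def by blast
  have "(\<Sum>p<n. \<Sum>q<n. (v $ (p * n + q))\<^sup>2)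
      \<le> R * (\<Sum>p<n. \<Sum>q<n. \<bar>v $ (p * n + q)\<bar> * \<bar>f $ (p * n + q)\<bar>)"
    unfolding R_def
  proof (rule two_dim_stability[OF \<theta> coercive \<alpha> _ _ s])
    show "\<alpha> \<le> a (lgl_node N (i + 1)) \<and> a (lgl_node N (i + 1)) \<le> \<beta>" if "i < n" for i
      using a node[OF that] by blast
    show "\<alpha> \<le> b (lgl_node N (i + 1)) \<and> b (lgl_node N (i + 1)) \<le> \<beta>" if "i < n" for i
      using b node[OF that] by blast
    fix p q assume pq: "p < n" "q < n"
    have "f $ (p * n + q) = (K_L N a b *\<^sub>v v) $ (p * n + q) + s * v $ (p * n + q)"
      using grid_index(1)[OF pq] K v by (simp add: f_def)
    then show "f $ (p * n + q)
      = - (a (lgl_node N (q + 1)) * (\<Sum>t<n. D2_mat N $$ (q, t) * v $ (p * n + t)))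
        - b (lgl_node N (p + 1)) * (\<Sum>r<n. D2_mat N $$ (p, r) * v $ (r * n + q)) + s * v $ (p * n + q)"
      using K_L_mult_vec[of v N p q a b] v pq by (simp add: n_def)
  qed auto
  then have "(vec_norm2 v)\<^sup>2 \<le> R * (\<Sum>k<n * n. \<bar>v $ k\<bar> * \<bar>f $ k\<bar>)"
    using v by (simp add: vec_norm2_square sum_grid)
  also have "\<dots> \<le> R * (vec_norm2 v * vec_norm2 f)"
    using L2_set_mult_ineq[of "\<lambda>k. v $ k" "\<lambda>k. f $ k" "{..<n * n}"] v f R
    by (intro mult_left_mono) (simp_all add: vec_norm2_L2_set)
  finally have "vec_norm2 v * vec_norm2 v \<le> vec_norm2 v * (R * vec_norm2 f)"
    by (simp add: power2_eq_square mult_ac)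
  then have "vec_norm2 v \<le> R * vec_norm2 f"
    using vec_norm2_nonneg[of v] vec_norm2_nonneg[of f] R
    by (cases "vec_norm2 v = 0") (simp_all only: mult_le_cancel_left_pos less_le mult_nonneg_nonneg simp_thms)
  then show ?thesis by (simp only: R_def f_def)
qed

text \<open>Stability makes the shifted matrix injective, hence invertible, and is at the same time
  a bound for its inverse. The final theorem needs this for its own \<open>s\<close> and, with
  \<open>s = 0\<close>, for \<open>K_L\<close> itself.\<close>

lemma K_L_shift:
  fixes N :: nat
  defines "m \<equiv> (N - 1) * (N - 1)"
  assumes N: "2 \<le> N" and \<alpha>: "0 < \<alpha>"
    and a: "\<forall>x\<in>{-1..1}. \<alpha> \<le> a x \<and> a x \<le> \<beta>"
    and b: "\<forall>y\<in>{-1..1}. \<alpha> \<le> b y \<and> b y \<le> \<beta>"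
    and s: "0 \<le> s"
  defines "M \<equiv> K_L N a b + s \<cdot>\<^sub>m 1\<^sub>m m"
  shows "M \<in> carrier_mat m m" "inv_mat M \<in> carrier_mat m m"
    "M * inv_mat M = 1\<^sub>m m" "inv_mat M * M = 1\<^sub>m m" "invertible_mat M"
    "\<And>v. v \<in> carrier_vec m \<Longrightarrow> M *\<^sub>v v = K_L N a b *\<^sub>v v + s \<cdot>\<^sub>v v"
    "\<And>f. f \<in> carrier_vec m \<Longrightarrow> vec_norm2 (inv_mat M *\<^sub>v f) \<le> 4 * \<beta> / \<alpha>\<^sup>2 * vec_norm2 f"
proof -
  have K: "K_L N a b \<in> carrier_mat m m" by (simp add: m_def K_L_carrier)
  show M: "M \<in> carrier_mat m m" using K by (simp add: M_def)
  show act: "M *\<^sub>v v = K_L N a b *\<^sub>v v + s \<cdot>\<^sub>v v" if "v \<in> carrier_vec m" for v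
    using K that by (auto simp: M_def add_mult_distrib_mat_vec[OF K])
  have stab: "vec_norm2 v \<le> 4 * \<beta> / \<alpha>\<^sup>2 * vec_norm2 (M *\<^sub>v v)" if "v \<in> carrier_vec m" for v
    using K_L_stability[OF N \<alpha> a b s, of v] that by (simp add: act m_def)
  have "v = 0\<^sub>v m" if v: "v \<in> carrier_vec m" "M *\<^sub>v v = 0\<^sub>v m" for v
  proof -
    have "vec_norm2 (0\<^sub>v m :: real vec) = 0" by (simp add: vec_norm2_def)
    then have "vec_norm2 v = 0"
      using stab[OF v(1)] v(2) vec_norm2_nonneg[of v] by simp
    then show ?thesis by (rule vec_norm2_eq_0[OF v(1)])
  qed
  note inv = inv_mat_injective[OF M this]
  show "inv_mat M \<in> carrier_mat m m" "M * inv_mat M = 1\<^sub>m m" "inv_mat M * M = 1\<^sub>m m" "invertible_mat M"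
    using inv by auto
  show "vec_norm2 (inv_mat M *\<^sub>v f) \<le> 4 * \<beta> / \<alpha>\<^sup>2 * vec_norm2 f" if f: "f \<in> carrier_vec m" for f
  proof -
    have "M *\<^sub>v (inv_mat M *\<^sub>v f) = f"
      using assoc_mult_mat_vec[OF M inv(1) f] inv(2) f by simp
    then show ?thesis using stab[of "inv_mat M *\<^sub>v f"] inv(1) f by simp
  qed
qed

text \<open>Both factors are diagonal and each diagonal entry of the product is a value
  \<open>c x * d y\<close> at a pair of nodes, so the reaction term is a multiple of the
  identity.\<close>

lemma coeff_kronecker_const:
  assumes "1 \<le> N"
    and "\<And>x y. x \<in> {-1..1} \<Longrightarrow> y \<in> {-1..1} \<Longrightarrow> c x * d y = s"
  shows "coeff_mat N d \<otimes>\<^sub>K coeff_mat N c = s \<cdot>\<^sub>m 1\<^sub>m ((N - 1) * (N - 1))"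
proof (rule eq_matI)
  fix i j
  assume "i < dim_row (s \<cdot>\<^sub>m 1\<^sub>m ((N - 1) * (N - 1)))" "j < dim_col (s \<cdot>\<^sub>m 1\<^sub>m ((N - 1) * (N - 1)))"
  then have i: "i < (N - 1) * (N - 1)" and j: "j < (N - 1) * (N - 1)" by auto
  note i' = div_mod_less[OF i] and j' = div_mod_less[OF j]
  have same: "i div (N - 1) = j div (N - 1) \<and> i mod (N - 1) = j mod (N - 1) \<longleftrightarrow> i = j"
    by (metis div_mult_mod_eq)
  have node: "lgl_node N (k + 1) \<in> {-1..1}" if "k < N - 1" for k
    using lgl_node_bounds[OF assms(1), of "k + 1"] that by auto
  have entry: "coeff_mat N f $$ (k, l) = (if k = l then f (lgl_node N (k + 1)) else 0)"
    if "k < N - 1" "l < N - 1" for f k l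
    using that by (simp add: coeff_mat_def mat_diag_def)
  have "c (lgl_node N (i mod (N - 1) + 1)) * d (lgl_node N (i div (N - 1) + 1)) = s"
    by (intro assms(2) node i')
  then show "(coeff_mat N d \<otimes>\<^sub>K coeff_mat N c) $$ (i, j) = (s \<cdot>\<^sub>m 1\<^sub>m ((N - 1) * (N - 1))) $$ (i, j)"
    using same i j
    by (auto simp: index_kronecker[OF coeff_carrier coeff_carrier i j] entry[OF i'(1) j'(1)]
      entry[OF i'(2) j'(2)] mult.commute)
qed (use kronecker_carrier[OF coeff_carrier coeff_carrier, of N d N c] in auto)

text \<open>By \<open>kronecker_mult\<close> each term of \<open>K_L\<close> absorbs one
  \<open>B_mat\<close> per factor: in one factor it cancels \<open>D2_mat\<close>, in the other it
  replaces the identity.\<close>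

lemma K_B_factor:
  assumes N: "2 \<le> N"
  shows "K_B N a b = K_L N a b * (B_mat N \<otimes>\<^sub>K B_mat N)"
proof -
  note [intro] = kronecker_carrier coeff_carrier D2_carrier B_carrier one_carrier_mat mult_carrier_mat
  have CDB: "coeff_mat N f * D2_mat N * B_mat N = coeff_mat N f" for f
    using assoc_mult_mat[OF coeff_carrier[of N f] D2_carrier B_carrier] right_mult_one_mat[OF coeff_carrier[of N f]]
    by (simp add: D2_B[OF N])
  have "(1\<^sub>m (N - 1) \<otimes>\<^sub>K (coeff_mat N a * D2_mat N)) * (B_mat N \<otimes>\<^sub>K B_mat N) = B_mat N \<otimes>\<^sub>K coeff_mat N a"
    by (subst kronecker_mult[OF one_carrier_mat mult_carrier_mat[OF coeff_carrier D2_carrier]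
          B_carrier B_carrier])
       (simp add: CDB left_mult_one_mat[OF B_carrier])
  moreover have "((coeff_mat N b * D2_mat N) \<otimes>\<^sub>K 1\<^sub>m (N - 1)) * (B_mat N \<otimes>\<^sub>K B_mat N) = coeff_mat N b \<otimes>\<^sub>K B_mat N"
    by (subst kronecker_mult[OF mult_carrier_mat[OF coeff_carrier D2_carrier] one_carrier_mat
          B_carrier B_carrier])
       (simp add: CDB left_mult_one_mat[OF B_carrier])
  ultimately show ?thesis
    unfolding K_L_def K_B_def
    using uminus_mult_left_mat[of "1\<^sub>m (N - 1) \<otimes>\<^sub>K (coeff_mat N a * D2_mat N)" "B_mat N \<otimes>\<^sub>K B_mat N"]
      kronecker_carrier[OF one_carrier_mat[of "N - 1"] mult_carrier_mat[OF coeff_carrier[of N a] D2_carrier]]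
      kronecker_carrier[OF B_carrier[of N] B_carrier[of N]]
    by (subst minus_mult_distrib_mat[of _ "(N - 1) * (N - 1)" "(N - 1) * (N - 1)" _ _ "(N - 1) * (N - 1)"])
       auto
qed

lemma A_B_factor:
  assumes N: "2 \<le> N"
  shows "A_B N a b c d = A_L N a b c d * (B_mat N \<otimes>\<^sub>K B_mat N)"
proof -
  note [intro] = kronecker_carrier coeff_carrier B_carrier K_L_carrier
  have "(coeff_mat N d \<otimes>\<^sub>K coeff_mat N c) * (B_mat N \<otimes>\<^sub>K B_mat N)
      = (coeff_mat N d * B_mat N) \<otimes>\<^sub>K (coeff_mat N c * B_mat N)"
    by (rule kronecker_mult) auto
  then show ?thesis
    unfolding A_L_def A_B_def K_B_factor[OF N]
    by (subst add_mult_distrib_mat[of _ "(N - 1) * (N - 1)" "(N - 1) * (N - 1)" _ _ "(N - 1) * (N - 1)"])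
       auto
qed

text \<open>\<open>BB\<close> has the inverse \<open>DD\<close>, so \<open>K * BB\<close> has the
  inverse \<open>DD * inv_mat K\<close>, and the common right factor \<open>BB\<close> of
  \<open>A_B\<close> and \<open>K_B\<close> cancels in the preconditioned product.\<close>

lemma birkhoff_preconditioned_eq:
  assumes N: "2 \<le> N" and inv: "inv_mat (K_L N a b) \<in> carrier_mat ((N - 1) * (N - 1)) ((N - 1) * (N - 1))"
    "K_L N a b * inv_mat (K_L N a b) = 1\<^sub>m ((N - 1) * (N - 1))"
    and A: "A_L N a b c d \<in> carrier_mat ((N - 1) * (N - 1)) ((N - 1) * (N - 1))"
  shows "invertible_mat (K_B N a b)" "A_B N a b c d * P_B N a b = A_L N a b c d * P_L N a b"
proof -
  define m where "m = (N - 1) * (N - 1)"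
  define BB where "BB = B_mat N \<otimes>\<^sub>K B_mat N"
  define DD where "DD = D2_mat N \<otimes>\<^sub>K D2_mat N"
  define K where "K = K_L N a b"
  have BB: "BB \<in> carrier_mat m m" and DD: "DD \<in> carrier_mat m m"
    unfolding BB_def DD_def m_def by (intro kronecker_carrier B_carrier D2_carrier)+
  have K: "K \<in> carrier_mat m m" by (simp add: K_def m_def K_L_carrier)
  have KI: "inv_mat K \<in> carrier_mat m m" "K * inv_mat K = 1\<^sub>m m"
    using inv by (simp_all add: K_def m_def)
  have "B_mat N * D2_mat N = 1\<^sub>m (N - 1)" using N by (simp add: B_mat_eq D2_inverse)
  then have BD: "BB * DD = 1\<^sub>m m"
    unfolding BB_def DD_def m_def
    by (subst kronecker_mult[OF B_carrier B_carrier D2_carrier D2_carrier]) (simp add: kronecker_one)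
  have cancel: "X * BB * (DD * inv_mat K) = X * inv_mat K" if X: "X \<in> carrier_mat m m" for X
  proof -
    have "X * BB * (DD * inv_mat K) = X * (BB * DD * inv_mat K)"
      unfolding assoc_mult_mat[OF BB DD KI(1)] using KI(1) DD
      by (intro assoc_mult_mat[OF X BB]) auto
    then show ?thesis using KI(1) by (simp add: BD)
  qed
  have K_B: "K_B N a b = K * BB" by (simp add: K_B_factor[OF N] K_def BB_def)
  have KBB: "K * BB \<in> carrier_mat m m" and DK: "DD * inv_mat K \<in> carrier_mat m m"
    using K BB DD KI by auto
  have one: "K * BB * (DD * inv_mat K) = 1\<^sub>m m" unfolding cancel[OF K] by (rule KI(2))
  show "invertible_mat (K_B N a b)" unfolding K_B by (rule inv_mat_unique(2)[OF KBB DK one])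
  have "P_B N a b = DD * inv_mat K"
    unfolding P_B_def K_B by (rule inv_mat_unique(1)[OF KBB DK one])
  then show "A_B N a b c d * P_B N a b = A_L N a b c d * P_L N a b"
    using cancel A by (simp add: A_B_factor[OF N] BB_def[symmetric] P_L_def K_def m_def)
qed

text \<open>Invertibility is part of the claim because \<open>inv_mat\<close>, and with it
  \<open>P_L\<close>, \<open>P_B\<close> and \<open>cond2\<close>, is meaningful only for invertible
  matrices.\<close>

theorem theorem3p4:
  fixes a b c d :: "real \<Rightarrow> real" and \<alpha> \<beta> s :: real
  assumes "continuous_on {-1..1} a" "continuous_on {-1..1} b"
    and "continuous_on {-1..1} c" "continuous_on {-1..1} d"
    and "0 < \<alpha>"
    and "\<And>x. x \<in> {-1..1} \<Longrightarrow> \<alpha> \<le> a x \<and> a x \<le> \<beta>"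
    and "\<And>y. y \<in> {-1..1} \<Longrightarrow> \<alpha> \<le> b y \<and> b y \<le> \<beta>"
    and "0 \<le> s"
    and "\<And>x y. x \<in> {-1..1} \<Longrightarrow> y \<in> {-1..1} \<Longrightarrow> c x * d y = s"
  shows "\<exists>C::real. \<forall>N\<ge>2.
    invertible_mat (K_L N a b) \<and> invertible_mat (K_B N a b) \<and>
    invertible_mat (A_L N a b c d * P_L N a b) \<and>
    invertible_mat (A_B N a b c d * P_B N a b) \<and>
    cond2 (A_L N a b c d * P_L N a b) = cond2 (A_B N a b c d * P_B N a b) \<and>
    cond2 (A_L N a b c d * P_L N a b) \<le> C"
proof (intro exI[of _ "(1 + s * (4 * \<beta> / \<alpha>\<^sup>2)) * (1 + s * (4 * \<beta> / \<alpha>\<^sup>2))"] allI impI)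
  fix N :: nat assume N: "2 \<le> N"
  define m where "m = (N - 1) * (N - 1)"
  define R where "R = 4 * \<beta> / \<alpha>\<^sup>2"
  define K where "K = K_L N a b"
  define M where "M = K + s \<cdot>\<^sub>m 1\<^sub>m m"
  have s: "0 \<le> s" by fact
  have a: "\<forall>x\<in>{-1..1}. \<alpha> \<le> a x \<and> a x \<le> \<beta>" and b: "\<forall>y\<in>{-1..1}. \<alpha> \<le> b y \<and> b y \<le> \<beta>"
    using assms(6,7) by blast+
  have R: "0 \<le> R" using assms(5) assms(6)[of 0] by (simp add: R_def)
  have K: "K \<in> carrier_mat m m" by (simp add: K_def m_def K_L_carrier)
  have K0: "K + 0 \<cdot>\<^sub>m 1\<^sub>m m = K" using K by (intro eq_matI) auto
  note KI = K_L_shift[OF N assms(5) a b order.refl, folded m_def K_def, unfolded K0]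
  note MI = K_L_shift[OF N assms(5) a b s, folded m_def K_def, folded M_def]
  have A: "A_L N a b c d = M"
    unfolding A_L_def M_def K_def m_def using coeff_kronecker_const[OF _ assms(9), of N] N by simp
  \<comment> \<open>\<open>F\<close> is the preconditioned matrix, equal to 1 + s K^-1, and
    \<open>G\<close> is its inverse, equal to 1 - s M^-1. As \<open>R\<close> bounds both K^-1 and
    M^-1, each of the two norms is at most \<open>1 + s * R\<close>.\<close>
  define F where "F = M * inv_mat K"
  define G where "G = K * inv_mat M"
  have F: "F \<in> carrier_mat m m" and G: "G \<in> carrier_mat m m"
    using K KI(2) MI(1,2) by (auto simp: F_def G_def)
  have "F * G = M * (inv_mat K * G)"
    unfolding F_def by (rule assoc_mult_mat[OF MI(1) KI(2) G])
  also have "inv_mat K * G = inv_mat K * K * inv_mat M"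
    unfolding G_def by (rule assoc_mult_mat[OF KI(2) K MI(2), symmetric])
  finally have FG: "F * G = 1\<^sub>m m" using MI(2,3) by (simp add: KI(4))
  have inv_F: "inv_mat F = G" "invertible_mat F" by (rule inv_mat_unique[OF F G FG])+
  have F_bound: "vec_norm2 (F *\<^sub>v f) \<le> (1 + s * R) * vec_norm2 f" if f: "f \<in> carrier_vec m" for f
  proof -
    define v where "v = inv_mat K *\<^sub>v f"
    have v: "v \<in> carrier_vec m" using KI(2) f by (simp add: v_def)
    have "K *\<^sub>v v = f"
      unfolding v_def using assoc_mult_mat_vec[OF K KI(2) f] KI(3) f by simp
    then have "F *\<^sub>v f = f + s \<cdot>\<^sub>v v"
      unfolding F_def using assoc_mult_mat_vec[OF MI(1) KI(2) f] MI(6)[OF v] by (simp add: v_def)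
    then have "vec_norm2 (F *\<^sub>v f) \<le> vec_norm2 f + \<bar>s\<bar> * vec_norm2 v"
      using vec_norm2_add_smult[OF f v] by simp
    also have "\<dots> \<le> vec_norm2 f + \<bar>s\<bar> * (R * vec_norm2 f)"
      using KI(7)[OF f] by (intro add_left_mono mult_left_mono) (simp_all add: R_def v_def)
    finally show ?thesis using s by (simp add: algebra_simps)
  qed
  have G_bound: "vec_norm2 (G *\<^sub>v f) \<le> (1 + s * R) * vec_norm2 f" if f: "f \<in> carrier_vec m" for f
  proof -
    define v where "v = inv_mat M *\<^sub>v f"
    have v: "v \<in> carrier_vec m" using MI(2) f by (simp add: v_def)
    have "M *\<^sub>v v = f"
      unfolding v_def using assoc_mult_mat_vec[OF MI(1,2) f] MI(3) f by simp
    then have "K *\<^sub>v v + s \<cdot>\<^sub>v v = f" by (simp only: MI(6)[OF v])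
    then have "K *\<^sub>v v = f + (- s) \<cdot>\<^sub>v v"
      using K v by (auto intro!: eq_vecI)
    then have "G *\<^sub>v f = f + (- s) \<cdot>\<^sub>v v"
      unfolding G_def using assoc_mult_mat_vec[OF K MI(2) f] by (simp add: v_def)
    then have "vec_norm2 (G *\<^sub>v f) \<le> vec_norm2 f + \<bar>- s\<bar> * vec_norm2 v"
      using vec_norm2_add_smult[OF f v, of "- s"] by simp
    also have "\<dots> \<le> vec_norm2 f + \<bar>- s\<bar> * (R * vec_norm2 f)"
      using MI(7)[OF f] by (intro add_left_mono mult_left_mono) (simp_all add: R_def v_def)
    finally show ?thesis using s by (simp add: algebra_simps)
  qed
  have C: "0 \<le> 1 + s * R" using s R by simp
  have cond: "cond2 F \<le> (1 + s * R) * (1 + s * R)"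
    unfolding cond2_def inv_F(1)
    using mat_norm2_bounds[OF F C F_bound] mat_norm2_bounds[OF G C G_bound] C
    by (intro mult_mono) auto
  have F_eq: "A_L N a b c d * P_L N a b = F"
    by (simp add: A F_def P_L_def K_def)
  have "invertible_mat (K_B N a b)" "A_B N a b c d * P_B N a b = F"
    using birkhoff_preconditioned_eq[OF N, of a b c d] KI(2,3) MI(1) F_eq
    by (simp_all add: A m_def K_def)
  then show "invertible_mat (K_L N a b) \<and> invertible_mat (K_B N a b) \<and>
    invertible_mat (A_L N a b c d * P_L N a b) \<and>
    invertible_mat (A_B N a b c d * P_B N a b) \<and>
    cond2 (A_L N a b c d * P_L N a b) = cond2 (A_B N a b c d * P_B N a b) \<and>
    cond2 (A_L N a b c d * P_L N a b) \<le> (1 + s * (4 * \<beta> / \<alpha>\<^sup>2)) * (1 + s * (4 * \<beta> / \<alpha>\<^sup>2))"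
    using KI(5) inv_F(2) cond F_eq by (simp add: K_def R_def)
qed

end
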